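(* Let $\Delta\in[0,+\infty)$, $\rho\in(0,+\infty)$, and let $x$ be any solution of $$x''(t)+p(t)x(t-\tau(t))=0$$ on $[-\vartheta_\Delta,+\infty)$, with $\operatorname{ess\,sup}_{t\in\mathbb{R}}|p(t)|\le 1$ and $\tau_m\le\Delta$, such that $$\max_{t\in[-\Delta-\vartheta_\Delta,0]}|x(t)|\le\rho,\qquad x(0)=0,$$ $$1\ge x(t)\ge 0,\ t\in[0,A],\qquad x(A)=1,\quad x'(A)=0 .$$ Then $\Psi(\rho,\Delta)\le A$ and $$x(t)\le y_{\rho,\Delta}(-t),\qquad t\in[0,\Psi(\rho,\Delta)].$$
   Context: Equation and solutions. $\tau:\mathbb{R}\to[0,+\infty)$ and $p:\mathbb{R}\to\mathbb{R}$ are Lebesgue measurable and essentially bounded. A solution on $[s,+\infty)$ (here $s=-\vartheta_\Delta$) is a function $x:[s-\tau_m,+\infty)\to\mathbb{R}$, with $\tau_m:=\operatorname{ess\,sup}\{\tau(t):t\ge s\}$, absolutely continuous together with its first derivative, satisfying the equation a.e. on $[s,+\infty)$. If $\tau_m<\Delta$, the maximum over $[-\Delta-\vartheta_\Delta,0]$ is taken over those points of this interval at which $x$ is defined. The function $r_\Delta$ and the number $\vartheta_\Delta$. For $\Delta\ge 0$, $r_\Delta:\mathbb{R}\to\mathbb{R}$ is the solution of $r_\Delta''(t)+r_\Delta(t-\Delta)=0$ for $t\ge 0$, with $r_\Delta(t)=1$ for $t\le 0$ and $r_\Delta'(0)=0$. $\vartheta_\Delta>0$ denotes its first zero (it is known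 that $r_\Delta$ is strictly decreasing on $[0,\vartheta_\Delta]$ and that $\vartheta_\Delta\geq\sqrt2$ is continuous in $\Delta$; for $\Delta=0$, $r_0=\cos$ on $[0,+\infty)$ and $\vartheta_0=\pi/2$). $\Psi(\rho,\Delta)$ and $y_{\rho,\Delta}$. Let $\chi_S$ be the characteristic function of $S\subset\mathbb{R}$. Set $\beta_0(t)\equiv 1$ for $t\le 0$ and, for $n=0,1,2,\dots$, let $\varpi_n\in(0,+\infty)$ be the unique number with $$\int_{-\varpi_n}^{0}\Big[\int_{-\varpi_n}^{u}\max\{\beta_n(v),\rho\, r_\Delta(\vartheta_\Delta-v-\Delta)\chi_{[-\Delta,0]}(v)\}\,dv\Big]du=1,$$ and put $\beta_{n+1}(t)=1$ for $t\le-\varpi_n$ and $$\beta_{n+1}(t)=1-\int_{-\varpi_n}^{t}\Big[\int_{-\varpi_n}^{u}\max\{\beta_n(v),\rho\, r_\Delta(\vartheta_\Delta-v-\Delta)\chi_{[-\Delta,0]}(v)\}\,dv\Big]du,\qquad t\in[-\varpi_n,0].$$ These are well-defined, $\varpi_n$ is nondecreasing and bounded by $\pi/2$, and $\beta_n$ is pointwise nonincreasing in $n$. $\Psi(\rho,\Delta):=\lim_{n\to\infty}\varpi_n$ and $y_{\rho,\Delta}(w):=\lim_{n\to\infty}\beta_n(w)$, $w\le 0$. *)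

theory Defs
  imports "HOL-Analysis.Analysis" "HOL-Probability.Essential_Supremum"
begin

definition abs_cont_on_interval :: "(real \<Rightarrow> real) \<Rightarrow> real \<Rightarrow> real \<Rightarrow> bool" where
  "abs_cont_on_interval f a b \<longleftrightarrow>
    (\<forall>\<epsilon>>0. \<exists>\<delta>>0. \<forall>(n::nat) u v.
       (\<forall>i<n. a \<le> u i \<and> u i \<le> v i \<and> v i \<le> b) \<longrightarrow>
       disjoint_family_on (\<lambda>i. {u i<..<v i}) {..<n} \<longrightarrow>
       (\<Sum>i<n. v i - u i) < \<delta> \<longrightarrow>
       (\<Sum>i<n. \<bar>f (v i) - f (u i)\<bar>) < \<epsilon>)"

text \<open>On the unbounded interval \<open>[a, \<infinity>)\<close>, absolute continuity means absolute continuity on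
  every compact subinterval.\<close>

definition abs_cont_from :: "real \<Rightarrow> (real \<Rightarrow> real) \<Rightarrow> bool" where
  "abs_cont_from a f \<longleftrightarrow> (\<forall>b\<ge>a. abs_cont_on_interval f a b)"

text \<open>The essential supremum in the library takes values in a complete linear order, here
  \<^typ>\<open>ereal\<close>. For an essentially bounded nonnegative \<open>\<tau>\<close> it is a nonnegative real.\<close>

definition max_delay :: "(real \<Rightarrow> real) \<Rightarrow> real \<Rightarrow> real" where
  "max_delay \<tau> s = real_of_ereal (esssup (lebesgue_on {s..}) (\<lambda>t. ereal (\<tau> t)))"

text \<open>A solution is represented by a total function, of which only the values on
  \<open>[s - max_delay \<tau> s, \<infinity>)\<close> are constrained.\<close>

definition delay_solution ::
  "(real \<Rightarrow> real) \<Rightarrow> (real \<Rightarrow> real) \<Rightarrow> real \<Rightarrow> (real \<Rightarrow> real) \<Rightarrow> bool" where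
  "delay_solution p \<tau> s x \<longleftrightarrow>
    (let a = s - max_delay \<tau> s in
      abs_cont_from a x \<and>
      (\<exists>x'. (\<forall>t\<ge>a. (x has_real_derivative x' t) (at t within {a..})) \<and>
            abs_cont_from a x' \<and>
            (AE t in lebesgue_on {s..}.
               (x' has_real_derivative - p t * x (t - \<tau> t)) (at t))))"

definition is_r :: "real \<Rightarrow> (real \<Rightarrow> real) \<Rightarrow> bool" where
  "is_r \<Delta> r \<longleftrightarrow>
    (\<forall>t\<le>0. r t = 1) \<and>
    (\<exists>r'. (\<forall>t. (r has_real_derivative r' t) (at t)) \<and> r' 0 = 0 \<and>
          (\<forall>t\<ge>0. (r' has_real_derivative - r (t - \<Delta>)) (at t within {0..})))"

definition r :: "real \<Rightarrow> real \<Rightarrow> real" where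
  "r \<Delta> = (THE f. is_r \<Delta> f)"

definition \<theta> :: "real \<Rightarrow> real" where
  "\<theta> \<Delta> = (LEAST t. 0 < t \<and> r \<Delta> t = 0)"

definition integrand :: "real \<Rightarrow> real \<Rightarrow> (real \<Rightarrow> real) \<Rightarrow> real \<Rightarrow> real" where
  "integrand \<rho> \<Delta> b v =
    max (b v) (\<rho> * r \<Delta> (\<theta> \<Delta> - v - \<Delta>) * indicator {-\<Delta>..0} v)"

definition double_integral :: "real \<Rightarrow> real \<Rightarrow> (real \<Rightarrow> real) \<Rightarrow> real \<Rightarrow> real \<Rightarrow> real" where
  "double_integral \<rho> \<Delta> b w t =
    integral {-w..t} (\<lambda>u. integral {-w..u} (integrand \<rho> \<Delta> b))"

definition next_varpi :: "real \<Rightarrow> real \<Rightarrow> (real \<Rightarrow> real) \<Rightarrow> real" where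
  "next_varpi \<rho> \<Delta> b = (THE w. 0 < w \<and> double_integral \<rho> \<Delta> b w 0 = 1)"

text \<open>Only the values of \<open>\<beta> \<rho> \<Delta> n\<close> on \<open>(-\<infinity>, 0]\<close> are meaningful; those at positive
  arguments are never used.\<close>

primrec \<beta> :: "real \<Rightarrow> real \<Rightarrow> nat \<Rightarrow> real \<Rightarrow> real" where
  "\<beta> \<rho> \<Delta> 0 = (\<lambda>t. 1)"
| "\<beta> \<rho> \<Delta> (Suc n) =
    (\<lambda>t. if t \<le> - next_varpi \<rho> \<Delta> (\<beta> \<rho> \<Delta> n) then 1
         else 1 - double_integral \<rho> \<Delta> (\<beta> \<rho> \<Delta> n) (next_varpi \<rho> \<Delta> (\<beta> \<rho> \<Delta> n)) t)"

definition varpi :: "real \<Rightarrow> real \<Rightarrow> nat \<Rightarrow> real" where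
  "varpi \<rho> \<Delta> n = next_varpi \<rho> \<Delta> (\<beta> \<rho> \<Delta> n)"

definition \<Psi> :: "real \<Rightarrow> real \<Rightarrow> real" where
  "\<Psi> \<rho> \<Delta> = lim (varpi \<rho> \<Delta>)"

definition y :: "real \<Rightarrow> real \<Rightarrow> real \<Rightarrow> real" where
  "y \<rho> \<Delta> w = lim (\<lambda>n. \<beta> \<rho> \<Delta> n w)"

end

theory Submission
  imports Defs
begin

text \<open>
  On \<open>[-\<theta> \<Delta>, 0]\<close> the solution is dominated by \<open>\<rho> * r \<Delta> (\<theta> \<Delta> + s)\<close>. Therefore, as soon as
  \<open>x t \<le> \<beta> \<rho> \<Delta> n (-t)\<close> on \<open>[0, A]\<close>, the delayed argument gives \<open>\<bar>x'' t\<bar> \<le> g (-t)\<close> almost everywhere,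
  where \<open>g\<close> is the \<open>n\<close>-th integrand. Integrating twice from \<open>A\<close>, where \<open>x = 1\<close> and \<open>x' = 0\<close>, down to \<open>0\<close>
  shows that the double integral of \<open>g\<close> over \<open>[-A, 0]\<close> is at least \<open>1\<close>, so \<open>varpi \<rho> \<Delta> n \<le> A\<close>. The difference
  \<open>\<beta> \<rho> \<Delta> (n + 1) (-t) - x t\<close> is concave on \<open>[0, varpi \<rho> \<Delta> n]\<close> and nonnegative at both ends, which yields
  the next bound. The same comparison, applied to \<open>\<beta> \<rho> \<Delta> (n + 2)\<close> in place of \<open>x\<close>, gives the monotonicity
  of both sequences, and the theorem follows in the limit.
\<close>

section \<open>Absolutely continuous functions\<close>

text \<open>The delayed time lies in [t - \<Delta>, t] and may be nonnegative or negative; the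
  \<open>max\<close> in \<open>integrand\<close> covers these two cases, by the current bound and by
  the bound on the prehistory. The main obstacle is regularity: \<open>x'\<close> is only absolutely
  continuous, so the bound on its derivative holds off a null set and concavity cannot be read off
  from a second derivative. All comparisons are therefore stated through increments of first
  derivatives, and \<open>abs_cont_increment_le\<close> turns almost everywhere bounds into bounds
  on increments. The domination before time zero looks circular, since |x''| is bounded by delayed
  values of |x| itself; a contraction of the constant breaks the circle. Finally, \<open>r\<close>,
  \<open>\<theta>\<close> and \<open>next_varpi\<close> are chosen by \<open>THE\<close> or
  \<open>LEAST\<close>, so each needs an existence proof, and those with \<open>THE\<close> a
  uniqueness proof as well, before anything can be said about it.\<close>

lemma sum_length_le_measure:
  fixes u v :: "nat \<Rightarrow> real"
  assumes "disjoint_family_on (\<lambda>i. {u i<..<v i}) {..<n}"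
    and "\<And>i. i < n \<Longrightarrow> u i \<le> v i"
    and "\<And>i. i < n \<Longrightarrow> {u i<..<v i} \<subseteq> U" and "U \<in> lmeasurable"
  shows "(\<Sum>i<n. v i - u i) \<le> measure lebesgue U"
proof -
  have "(\<Sum>i<n. v i - u i) = (\<Sum>i<n. measure lebesgue {u i<..<v i})"
    using assms(2) by (intro sum.cong) auto
  also have "\<dots> = measure lebesgue (\<Union>i<n. {u i<..<v i})"
    using assms(1) by (intro measure_finite_Union[symmetric]) (auto simp: emeasure_lborel_Ioo assms(2))
  also have "\<dots> \<le> measure lebesgue U"
    using assms(3,4) by (intro measure_mono_fmeasurable) auto
  finally show ?thesis .
qed

text \<open>Divisions obtained from a gauge are sets of tagged intervals, whereas
  \<open>abs_cont_on_interval\<close> speaks of finite sequences of endpoints. Intervals may share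
  endpoints, hence only the open interiors are disjoint.\<close>

lemma tagged_partial_division_enumerate:
  fixes q :: "(real \<times> real set) set"
  assumes "q tagged_partial_division_of {a..b}"
  obtains n u v where "\<And>i. i < n \<Longrightarrow> a \<le> u i \<and> u i \<le> v i \<and> v i \<le> b"
    and "disjoint_family_on (\<lambda>i::nat. {u i<..<v i}) {..<n}"
    and "\<And>i. i < n \<Longrightarrow> \<exists>t. (t, {u i..v i}) \<in> q"
    and "\<And>f::real \<Rightarrow> real. (\<Sum>(t, K)\<in>q. f (Sup K) - f (Inf K)) = (\<Sum>i<n. f (v i) - f (u i))"
proof -
  note q = tagged_partial_division_ofD[OF assms]
  obtain h where h: "bij_betw h {0..<card q} q"
    using ex_bij_betw_nat_finite q(1) by blast
  define n where "n = card q"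
  have h: "bij_betw h {..<n} q" using h by (simp add: n_def lessThan_atLeast0)
  define u where "u i = Inf (snd (h i))" for i
  define v where "v i = Sup (snd (h i))" for i
  have hq: "h i \<in> q" if "i < n" for i using h that by (auto simp: bij_betw_def)
  have int: "snd (h i) = {u i..v i} \<and> u i \<le> v i \<and> a \<le> u i \<and> v i \<le> b" if "i < n" for i
  proof -
    obtain t K where tK: "h i = (t, K)" by (cases "h i")
    then have "(t, K) \<in> q" using hq[OF that] by simp
    then obtain c d where cd: "K = cbox c d" "t \<in> K" "K \<subseteq> {a..b}" using q(2)[of t K] q(3)[of t K] q(4)[of t K] by auto
    then have "c \<le> d" by auto
    then have "u i = c" "v i = d" using tK cd by (auto simp: u_def v_def)
    then show ?thesis using tK cd \<open>c \<le> d\<close> by auto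
  qed
  show thesis
  proof (rule that[of n u v])
    show "a \<le> u i \<and> u i \<le> v i \<and> v i \<le> b" if "i < n" for i using int that by blast
    show "\<exists>t. (t, {u i..v i}) \<in> q" if "i < n" for i
      using int[OF that] hq[OF that] by (metis prod.collapse)
    show "disjoint_family_on (\<lambda>i. {u i<..<v i}) {..<n}"
      unfolding disjoint_family_on_def
    proof (intro ballI impI)
      fix i j assume ij: "i \<in> {..<n}" "j \<in> {..<n}" "i \<noteq> j"
      then have ne: "h i \<noteq> h j" using h by (auto simp: bij_betw_def inj_on_def)
      have "interior (snd (h i)) \<inter> interior (snd (h j)) = {}"
        using q(5)[of "fst (h i)" "snd (h i)" "fst (h j)" "snd (h j)"] ij ne hq by auto
      then show "{u i<..<v i} \<inter> {u j<..<v j} = {}"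
        using int ij by auto
    qed
    show "(\<Sum>(t, K)\<in>q. f (Sup K) - f (Inf K)) = (\<Sum>i<n. f (v i) - f (u i))" for f :: "real \<Rightarrow> real"
      by (subst sum.reindex_bij_betw[OF h, symmetric]) (simp add: u_def v_def case_prod_beta)
  qed
qed

lemma abs_cont_on_intervalE:
  assumes "abs_cont_on_interval F a b" "0 < \<epsilon>"
  obtains \<delta> where "0 < \<delta>"
    and "\<And>(n::nat) u v. (\<And>i. i < n \<Longrightarrow> a \<le> u i \<and> u i \<le> v i \<and> v i \<le> b) \<Longrightarrow>
       disjoint_family_on (\<lambda>i. {u i<..<v i}) {..<n} \<Longrightarrow> (\<Sum>i<n. v i - u i) < \<delta> \<Longrightarrow>
       (\<Sum>i<n. \<bar>F (v i) - F (u i)\<bar>) < \<epsilon>"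
proof -
  obtain \<delta> where \<delta>: "0 < \<delta>" "\<forall>(n::nat) u v. (\<forall>i<n. a \<le> u i \<and> u i \<le> v i \<and> v i \<le> b) \<longrightarrow>
       disjoint_family_on (\<lambda>i. {u i<..<v i}) {..<n} \<longrightarrow> (\<Sum>i<n. v i - u i) < \<delta> \<longrightarrow>
       (\<Sum>i<n. \<bar>F (v i) - F (u i)\<bar>) < \<epsilon>"
    using assms unfolding abs_cont_on_interval_def by (elim allE[of _ \<epsilon>] impE exE conjE)
  show thesis
    by (rule that[OF \<delta>(1)], rule \<delta>(2)[rule_format]) auto
qed

text \<open>By Cousin's lemma there is a fine tagged division: the intervals tagged outside \<open>N\<close> contribute at
  most \<open>e * (b - a)\<close> because of the sign of the derivative, and those tagged in \<open>N\<close> lie in an open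
  set of small measure, where absolute continuity applies.\<close>

lemma abs_cont_nonincreasing:
  assumes ac: "abs_cont_on_interval F a b" and "a \<le> b" and N: "negligible N"
    and der: "\<And>t. t \<in> {a..b} - N \<Longrightarrow> \<exists>D\<le>0. (F has_real_derivative D) (at t within {a..b})"
  shows "F b \<le> F a"
proof (rule field_le_epsilon)
  fix \<epsilon> :: real assume "0 < \<epsilon>"
  \<comment> \<open>The tags outside \<open>N\<close> will cost \<open>e * (b - a)\<close> and those
    in \<open>N\<close> at most \<open>e\<close>, which adds up to
    \<open>\<epsilon>\<close>.\<close>
  define e where "e = \<epsilon> / (1 + (b - a))"
  have e: "0 < e" "e * (1 + (b - a)) = \<epsilon>"
    using \<open>0 < \<epsilon>\<close> \<open>a \<le> b\<close> by (auto simp: e_def)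
  obtain \<delta> where "0 < \<delta>" and \<delta>: "\<And>(n::nat) u v. (\<And>i. i < n \<Longrightarrow> a \<le> u i \<and> u i \<le> v i \<and> v i \<le> b) \<Longrightarrow>
       disjoint_family_on (\<lambda>i. {u i<..<v i}) {..<n} \<Longrightarrow> (\<Sum>i<n. v i - u i) < \<delta> \<Longrightarrow>
       (\<Sum>i<n. \<bar>F (v i) - F (u i)\<bar>) < e"
    using ac \<open>0 < e\<close> by (rule abs_cont_on_intervalE) (rule that; blast)
  obtain U where U: "open U" "N \<subseteq> U" "U \<in> lmeasurable" "measure lebesgue U < \<delta>"
  proof -
    have N0: "N \<in> null_sets lebesgue" using N by (simp add: negligible_iff_null_sets)
    then have "N \<in> sets lebesgue" by auto
    then obtain T where T: "open T" "N \<subseteq> T" "emeasure lebesgue (T - N) < ennreal \<delta>"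
      using \<open>0 < \<delta>\<close> by (rule sets_lebesgue_outer_open)
    have "emeasure lebesgue T = emeasure lebesgue (T - N)"
      using N0 T(1) by (intro emeasure_Diff_null_set[symmetric]) auto
    then have *: "emeasure lebesgue T < ennreal \<delta>" using T by simp
    then have "T \<in> lmeasurable" using T(1) by (intro fmeasurableI) (auto simp: less_top[symmetric] top_unique)
    moreover from this * \<open>0 < \<delta>\<close> have "measure lebesgue T < \<delta>"
      by (simp add: emeasure_eq_measure2 ennreal_less_iff)
    ultimately show thesis using that T by blast
  qed
  have "\<exists>d>0. \<forall>u v. u \<le> t \<and> t \<le> v \<and> a \<le> u \<and> v \<le> b \<and> \<bar>u - t\<bar> < d \<and> \<bar>v - t\<bar> < d \<longrightarrow> F v - F u \<le> e * (v - u)"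
    if t: "t \<in> {a..b} - N" for t
  proof -
    obtain D where D: "D \<le> 0" "(F has_real_derivative D) (at t within {a..b})" using der t by blast
    then obtain d where "0 < d" and d: "\<And>y. y \<in> {a..b} \<Longrightarrow> \<bar>y - t\<bar> < d \<Longrightarrow> \<bar>F y - F t - D * (y - t)\<bar> \<le> e * \<bar>y - t\<bar>"
      using \<open>0 < e\<close> unfolding has_field_derivative_def has_derivative_within_alt by (metis real_norm_def)
    \<comment> \<open>As \<open>t\<close> lies between \<open>u\<close> and \<open>v\<close>, the
      errors \<open>e * (v - t)\<close> and \<open>e * (t - u)\<close> add up to exactly
      \<open>e * (v - u)\<close>.\<close>
    have "F v - F u \<le> e * (v - u)"
      if *: "u \<le> t" "t \<le> v" "a \<le> u" "v \<le> b" "\<bar>u - t\<bar> < d" "\<bar>v - t\<bar> < d" for u v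
    proof -
      have "\<bar>F v - F t - D * (v - t)\<bar> \<le> e * (v - t)" using d[of v] * t by auto
      moreover have "\<bar>F u - F t - D * (u - t)\<bar> \<le> e * (t - u)" using d[of u] * t by auto
      moreover have "D * (v - u) \<le> 0" using D(1) * by (simp add: mult_nonpos_nonneg)
      ultimately show ?thesis by (simp add: algebra_simps)
    qed
    then show ?thesis using \<open>0 < d\<close> by blast
  qed
  then obtain d where d: "\<And>t. t \<in> {a..b} - N \<Longrightarrow> 0 < d t"
    and dF: "\<And>t u v. t \<in> {a..b} - N \<Longrightarrow> u \<le> t \<Longrightarrow> t \<le> v \<Longrightarrow> a \<le> u \<Longrightarrow> v \<le> b \<Longrightarrow> \<bar>u - t\<bar> < d t \<Longrightarrow> \<bar>v - t\<bar> < d t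
        \<Longrightarrow> F v - F u \<le> e * (v - u)"
    by metis
  \<comment> \<open>No tag lies outside \<open>{a..b}\<close>; the unit ball is a default that makes
    \<open>\<gamma>\<close> a gauge on the whole line.\<close>
  define \<gamma> where "\<gamma> t = (if t \<in> N then U else if t \<in> {a..b} then ball t (d t) else ball t 1)" for t
  have "gauge \<gamma>" using U d by (auto simp: gauge_def \<gamma>_def)
  then obtain p where p: "p tagged_division_of {a..b}" "\<gamma> fine p" by (rule fine_division_exists_real)
  define q where "q = {x \<in> p. fst x \<in> N}"
  have pp: "p tagged_partial_division_of {a..b}" using p(1) by (simp add: tagged_division_of_def)
  have qp: "q tagged_partial_division_of {a..b}"
    by (rule tagged_partial_division_subset[OF pp]) (auto simp: q_def)
  note P = tagged_partial_division_ofD[OF pp]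
  have "(\<Sum>(t, K)\<in>q. F (Sup K) - F (Inf K)) \<le> e"
  proof -
    obtain n u v where uv: "\<And>i. i < n \<Longrightarrow> a \<le> u i \<and> u i \<le> v i \<and> v i \<le> b"
      "disjoint_family_on (\<lambda>i::nat. {u i<..<v i}) {..<n}"
      "\<And>i. i < n \<Longrightarrow> \<exists>t. (t, {u i..v i}) \<in> q"
      "\<And>f::real \<Rightarrow> real. (\<Sum>(t, K)\<in>q. f (Sup K) - f (Inf K)) = (\<Sum>i<n. f (v i) - f (u i))"
      by (rule tagged_partial_division_enumerate[OF qp]) (rule that; (blast | simp))
    have "{u i<..<v i} \<subseteq> U" if i: "i < n" for i
    proof -
      obtain t where t: "(t, {u i..v i}) \<in> p" "t \<in> N" using uv(3)[OF i] by (auto simp: q_def)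
      then have "{u i..v i} \<subseteq> U" using fineD[OF p(2) t(1)] by (simp add: \<gamma>_def)
      then show ?thesis by auto
    qed
    then have "(\<Sum>i<n. v i - u i) \<le> measure lebesgue U"
      using sum_length_le_measure[OF uv(2)] uv(1) U(3) by auto
    then have "(\<Sum>i<n. \<bar>F (v i) - F (u i)\<bar>) < e" using \<delta>[OF uv(1,2)] U(4) by simp
    moreover have "(\<Sum>i<n. F (v i) - F (u i)) \<le> (\<Sum>i<n. \<bar>F (v i) - F (u i)\<bar>)" by (intro sum_mono) simp
    ultimately show ?thesis using uv(4)[of F] by simp
  qed
  moreover have "(\<Sum>(t, K)\<in>p - q. F (Sup K) - F (Inf K)) \<le> (\<Sum>(t, K)\<in>p - q. e * (Sup K - Inf K))"
  proof (rule sum_mono, clarify)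
    fix t K assume tK: "(t, K) \<in> p" "(t, K) \<notin> q"
    obtain u v where K: "K = {u..v}" using P(4)[OF tK(1)] by auto
    have t: "u \<le> t" "t \<le> v" "a \<le> u" "v \<le> b" using P(2,3)[OF tK(1)] K by auto
    then have tN: "t \<in> {a..b} - N" using tK by (auto simp: q_def)
    then have "K \<subseteq> ball t (d t)" using fineD[OF p(2) tK(1)] by (auto simp: \<gamma>_def)
    moreover have "u \<in> K" "v \<in> K" using K t by auto
    ultimately have "u \<in> ball t (d t)" "v \<in> ball t (d t)" by blast+
    then have "F v - F u \<le> e * (v - u)" using dF[OF tN t] by (simp add: dist_real_def abs_minus_commute)
    then show "F (Sup K) - F (Inf K) \<le> e * (Sup K - Inf K)" using K t by simp
  qed
  moreover have "(\<Sum>(t, K)\<in>p - q. e * (Sup K - Inf K)) \<le> (\<Sum>(t, K)\<in>p. e * (Sup K - Inf K))"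
  proof (rule sum_mono2)
    fix x assume "x \<in> p - (p - q)"
    then obtain t K where x: "x = (t, K)" "(t, K) \<in> p" by (cases x) auto
    obtain u v where K: "K = {u..v}" using P(4)[OF x(2)] by auto
    then have "u \<le> v" using P(2)[OF x(2)] by auto
    then show "0 \<le> (case x of (t, K) \<Rightarrow> e * (Sup K - Inf K))" using x K \<open>0 < e\<close> by simp
  qed (use P in auto)
  moreover have "(\<Sum>(t, K)\<in>p. e * (Sup K - Inf K)) = e * (b - a)"
    using additive_tagged_division_1[OF \<open>a \<le> b\<close> p(1), of "\<lambda>x. e * x"] by (simp add: right_diff_distrib)
  moreover have "(\<Sum>(t, K)\<in>p. F (Sup K) - F (Inf K)) = F b - F a"
    using additive_tagged_division_1[OF \<open>a \<le> b\<close> p(1)] by simp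
  moreover have "(\<Sum>(t, K)\<in>p. F (Sup K) - F (Inf K)) =
      (\<Sum>(t, K)\<in>p - q. F (Sup K) - F (Inf K)) + (\<Sum>(t, K)\<in>q. F (Sup K) - F (Inf K))"
    by (rule sum.subset_diff) (use P in \<open>auto simp: q_def\<close>)
  ultimately have "F b - F a \<le> e * (1 + (b - a))" by (simp add: algebra_simps)
  then show "F b \<le> F a + \<epsilon>" using e(2) by simp
qed

lemma abs_cont_on_subinterval:
  assumes "abs_cont_on_interval F a b" "a \<le> c" "d \<le> b"
  shows "abs_cont_on_interval F c d"
  unfolding abs_cont_on_interval_def
proof (intro allI impI)
  fix \<epsilon> :: real assume \<epsilon>: "0 < \<epsilon>"
  obtain \<delta> where "0 < \<delta>" and \<delta>: "\<And>(n::nat) u v. (\<And>i. i < n \<Longrightarrow> a \<le> u i \<and> u i \<le> v i \<and> v i \<le> b) \<Longrightarrow>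
       disjoint_family_on (\<lambda>i. {u i<..<v i}) {..<n} \<Longrightarrow> (\<Sum>i<n. v i - u i) < \<delta> \<Longrightarrow>
       (\<Sum>i<n. \<bar>F (v i) - F (u i)\<bar>) < \<epsilon>"
    using assms(1) \<epsilon> by (rule abs_cont_on_intervalE) (rule that; blast)
  then show "\<exists>\<delta>>0. \<forall>(n::nat) u v. (\<forall>i<n. c \<le> u i \<and> u i \<le> v i \<and> v i \<le> d) \<longrightarrow>
       disjoint_family_on (\<lambda>i. {u i<..<v i}) {..<n} \<longrightarrow> (\<Sum>i<n. v i - u i) < \<delta> \<longrightarrow>
       (\<Sum>i<n. \<bar>F (v i) - F (u i)\<bar>) < \<epsilon>"
    using assms(2,3) by (intro exI[of _ \<delta>]) (fastforce intro!: \<delta>)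
qed

lemma abs_cont_on_imp_continuous_on:
  assumes "abs_cont_on_interval F a b"
  shows "continuous_on {a..b} F"
  unfolding continuous_on_iff
proof (intro ballI allI impI)
  fix t \<epsilon> :: real assume "t \<in> {a..b}" and \<epsilon>: "0 < \<epsilon>"
  obtain \<delta> where "0 < \<delta>" and \<delta>: "\<And>(n::nat) u v. (\<And>i. i < n \<Longrightarrow> a \<le> u i \<and> u i \<le> v i \<and> v i \<le> b) \<Longrightarrow>
       disjoint_family_on (\<lambda>i. {u i<..<v i}) {..<n} \<Longrightarrow> (\<Sum>i<n. v i - u i) < \<delta> \<Longrightarrow>
       (\<Sum>i<n. \<bar>F (v i) - F (u i)\<bar>) < \<epsilon>"
    using assms(1) \<epsilon> by (rule abs_cont_on_intervalE) (rule that; blast)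
  have "dist (F s) (F t) < \<epsilon>" if "s \<in> {a..b}" "dist s t < \<delta>" for s
    using \<delta>[of 1 "\<lambda>_. min s t" "\<lambda>_. max s t"] that \<open>t \<in> {a..b}\<close>
    by (cases "s \<le> t") (auto simp: dist_real_def disjoint_family_on_def abs_minus_commute)
  then show "\<exists>d>0. \<forall>s\<in>{a..b}. dist s t < d \<longrightarrow> dist (F s) (F t) < \<epsilon>" using \<open>0 < \<delta>\<close> by blast
qed

lemma abs_cont_cmult_diff_lipschitz:
  assumes "abs_cont_on_interval F a b" "0 \<le> L"
    and L: "\<And>s t. s \<in> {a..b} \<Longrightarrow> t \<in> {a..b} \<Longrightarrow> \<bar>G s - G t\<bar> \<le> L * \<bar>s - t\<bar>"
  shows "abs_cont_on_interval (\<lambda>t. c * F t - G t) a b"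
  unfolding abs_cont_on_interval_def
proof (intro allI impI)
  fix \<epsilon> :: real assume "0 < \<epsilon>"
  \<comment> \<open>The summand 1 here and in \<open>L + 1\<close> below keeps the denominators
    positive when \<open>c\<close> or \<open>L\<close> is zero; each half of the estimate gets
    \<open>\<epsilon> / 2\<close>.\<close>
  have \<epsilon>': "0 < \<epsilon> / (2 * (\<bar>c\<bar> + 1))" using \<open>0 < \<epsilon>\<close> by (simp add: divide_pos_pos)
  obtain \<delta> where "0 < \<delta>" and \<delta>: "\<And>(n::nat) u v. (\<And>i. i < n \<Longrightarrow> a \<le> u i \<and> u i \<le> v i \<and> v i \<le> b) \<Longrightarrow>
       disjoint_family_on (\<lambda>i. {u i<..<v i}) {..<n} \<Longrightarrow> (\<Sum>i<n. v i - u i) < \<delta> \<Longrightarrow>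
       (\<Sum>i<n. \<bar>F (v i) - F (u i)\<bar>) < \<epsilon> / (2 * (\<bar>c\<bar> + 1))"
    using assms(1) \<epsilon>' by (rule abs_cont_on_intervalE) (rule that; blast)
  define \<delta>' where "\<delta>' = min \<delta> (\<epsilon> / (2 * (L + 1)))"
  have "0 < \<delta>'" using \<open>0 < \<delta>\<close> \<open>0 < \<epsilon>\<close> \<open>0 \<le> L\<close> by (simp add: \<delta>'_def)
  moreover have "(\<Sum>i<n. \<bar>(c * F (v i) - G (v i)) - (c * F (u i) - G (u i))\<bar>) < \<epsilon>"
    if uv: "\<forall>i<n. a \<le> u i \<and> u i \<le> v i \<and> v i \<le> b" "disjoint_family_on (\<lambda>i. {u i<..<v i}) {..<n}"
      "(\<Sum>i<n. v i - u i) < \<delta>'" for n :: nat and u v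
  proof -
    let ?S = "\<Sum>i<n. \<bar>F (v i) - F (u i)\<bar>" and ?T = "\<Sum>i<n. v i - u i"
    have "\<bar>(c * F (v i) - G (v i)) - (c * F (u i) - G (u i))\<bar> \<le> \<bar>c\<bar> * \<bar>F (v i) - F (u i)\<bar> + L * (v i - u i)"
      if "i < n" for i
    proof -
      have "\<bar>G (v i) - G (u i)\<bar> \<le> L * (v i - u i)" using L[of "v i" "u i"] uv(1) that by fastforce
      moreover have "\<bar>c * (F (v i) - F (u i))\<bar> = \<bar>c\<bar> * \<bar>F (v i) - F (u i)\<bar>" by (rule abs_mult)
      ultimately show ?thesis by (simp add: right_diff_distrib)
    qed
    then have "(\<Sum>i<n. \<bar>(c * F (v i) - G (v i)) - (c * F (u i) - G (u i))\<bar>) \<le> \<bar>c\<bar> * ?S + L * ?T"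
      unfolding sum_distrib_left sum.distrib[symmetric] by (intro sum_mono) auto
    moreover have S: "?S < \<epsilon> / (2 * (\<bar>c\<bar> + 1))" using \<delta>[of n u v] uv by (auto simp: \<delta>'_def)
    have "\<bar>c\<bar> * ?S \<le> (\<bar>c\<bar> + 1) * ?S" by (simp add: mult_right_mono sum_nonneg)
    also have "\<dots> < \<epsilon> / 2" using S by (simp add: field_simps)
    moreover have "L * ?T \<le> (L + 1) * ?T" using uv(1) by (intro mult_right_mono sum_nonneg) auto
    moreover have "(L + 1) * ?T < \<epsilon> / 2"
    proof -
      have "?T < \<epsilon> / (2 * (L + 1))" using uv(3) by (simp add: \<delta>'_def)
      then show ?thesis using \<open>0 \<le> L\<close> by (simp add: field_simps)
    qed
    ultimately show ?thesis by linarith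
  qed
  ultimately show "\<exists>\<delta>>0. \<forall>(n::nat) u v. (\<forall>i<n. a \<le> u i \<and> u i \<le> v i \<and> v i \<le> b) \<longrightarrow>
       disjoint_family_on (\<lambda>i. {u i<..<v i}) {..<n} \<longrightarrow> (\<Sum>i<n. v i - u i) < \<delta> \<longrightarrow>
       (\<Sum>i<n. \<bar>(c * F (v i) - G (v i)) - (c * F (u i) - G (u i))\<bar>) < \<epsilon>"
    by blast
qed

lemma C1_lipschitz:
  fixes f :: "real \<Rightarrow> real"
  assumes "\<And>t. t \<in> {a..b} \<Longrightarrow> (f has_real_derivative f' t) (at t within {a..b})" "continuous_on {a..b} f'"
  obtains L where "0 \<le> L" "\<And>s t. s \<in> {a..b} \<Longrightarrow> t \<in> {a..b} \<Longrightarrow> \<bar>f s - f t\<bar> \<le> L * \<bar>s - t\<bar>"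
proof -
  have "bounded (f' ` {a..b})" by (intro compact_imp_bounded compact_continuous_image assms(2)) simp
  then obtain L where L: "0 < L" "\<And>t. t \<in> {a..b} \<Longrightarrow> \<bar>f' t\<bar> \<le> L" by (force simp: bounded_pos)
  have "\<bar>f s - f t\<bar> \<le> L * \<bar>s - t\<bar>" if "s \<in> {a..b}" "t \<in> {a..b}" for s t
    using field_differentiable_bound[of "{a..b}" f f' L s t] assms(1) L(2) that by auto
  then show thesis using that[of L] L(1) by simp
qed

text \<open>This replaces integrating \<open>c * F' \<le> g\<close>: subtracting the smooth
  \<open>G\<close> keeps absolute continuity, and the difference has a nonpositive derivative off
  \<open>N\<close>. In the applications \<open>c\<close> is a sign, so that a bound on the absolute
  value of a derivative can be used on either side.\<close>

lemma abs_cont_increment_le: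
  assumes ac: "abs_cont_on_interval F a b" and "a \<le> b" and N: "negligible N"
    and G: "\<And>t. t \<in> {a..b} \<Longrightarrow> (G has_real_derivative g t) (at t within {a..b})"
    and g: "continuous_on {a..b} g"
    and der: "\<And>t. t \<in> {a..b} - N \<Longrightarrow> \<exists>D. (F has_real_derivative D) (at t) \<and> c * D \<le> g t"
  shows "c * F b - c * F a \<le> G b - G a"
proof -
  obtain L where L: "0 \<le> L" "\<And>s t. s \<in> {a..b} \<Longrightarrow> t \<in> {a..b} \<Longrightarrow> \<bar>G s - G t\<bar> \<le> L * \<bar>s - t\<bar>"
    using C1_lipschitz[OF G g] by metis
  have "abs_cont_on_interval (\<lambda>t. c * F t - G t) a b"
    by (rule abs_cont_cmult_diff_lipschitz[OF ac L])
  moreover have "\<exists>D\<le>0. ((\<lambda>t. c * F t - G t) has_real_derivative D) (at t within {a..b})"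
    if t: "t \<in> {a..b} - N" for t
  proof -
    obtain D where "(F has_real_derivative D) (at t)" "c * D \<le> g t" using der[OF t] by blast
    then show ?thesis using G[of t] t
      by (intro exI[of _ "c * D - g t"]) (auto intro!: derivative_eq_intros intro: has_field_derivative_at_within)
  qed
  ultimately show ?thesis using abs_cont_nonincreasing[OF _ \<open>a \<le> b\<close> N] by force
qed

section \<open>The function \<open>r\<close> and its first zero\<close>

lemma nonincreasing_of_deriv:
  fixes f :: "real \<Rightarrow> real"
  assumes "a \<le> b" and "\<And>t. t \<in> {a..b} \<Longrightarrow> (f has_real_derivative f' t) (at t within {a..b})"
    and "\<And>t. t \<in> {a..b} \<Longrightarrow> f' t \<le> 0"
  shows "f b \<le> f a"
proof (rule DERIV_nonpos_imp_decreasing_open[OF \<open>a \<le> b\<close>])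
  fix t assume "a < t" "t < b"
  then have "(f has_real_derivative f' t) (at t)"
    using assms(2)[of t] at_within_interior[of t "{a..b}"] by simp
  then show "\<exists>y. (f has_real_derivative y) (at t) \<and> y \<le> 0" using assms(3)[of t] \<open>a < t\<close> \<open>t < b\<close> by auto
next
  show "continuous_on {a..b} f" using assms(2) by (rule DERIV_continuous_on)
qed

text \<open>Subtracting the line of slope \<open>f' t\<close> leaves a function whose derivative is
  nonnegative to the left of \<open>t\<close> and nonpositive to its right, hence maximal at
  \<open>t\<close>.\<close>

lemma nonincreasing_deriv_tangent:
  fixes f :: "real \<Rightarrow> real"
  assumes der: "\<And>t. t \<in> {a..b} \<Longrightarrow> (f has_real_derivative f' t) (at t within {a..b})"
    and mono: "\<And>s t. a \<le> s \<Longrightarrow> s \<le> t \<Longrightarrow> t \<le> b \<Longrightarrow> f' t \<le> f' s"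
    and "t \<in> {a..b}" "s \<in> {a..b}"
  shows "f s \<le> f t + f' t * (s - t)"
proof -
  have d: "((\<lambda>u. f u - f' t * u) has_real_derivative f' u - f' t) (at u within S)"
    if "u \<in> {a..b}" "S \<subseteq> {a..b}" for u S
    using DERIV_subset[OF der[OF that(1)] that(2)] by (auto intro!: derivative_eq_intros)
  show ?thesis
  proof (cases "t \<le> s")
    case True
    have "f s - f' t * s \<le> f t - f' t * t"
      by (rule nonincreasing_of_deriv[OF True d]) (use assms(3,4) mono in auto)
    then show ?thesis by (simp add: algebra_simps)
  next
    case False
    then have "s \<le> t" by simp
    then have "- (f t - f' t * t) \<le> - (f s - f' t * s)"
      by (rule nonincreasing_of_deriv[OF _ DERIV_minus[OF d]]) (use assms(3,4) mono in auto)
    then show ?thesis by (simp add: algebra_simps)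
  qed
qed

text \<open>The tangent inequalities at \<open>t\<close>, evaluated at \<open>a\<close> and
  \<open>b\<close> and weighted by \<open>b - t\<close> and \<open>t - a\<close>, add up so that the
  slope \<open>f' t\<close> cancels.\<close>

lemma nonincreasing_deriv_chord:
  fixes f :: "real \<Rightarrow> real"
  assumes der: "\<And>t. t \<in> {a..b} \<Longrightarrow> (f has_real_derivative f' t) (at t within {a..b})"
    and mono: "\<And>s t. a \<le> s \<Longrightarrow> s \<le> t \<Longrightarrow> t \<le> b \<Longrightarrow> f' t \<le> f' s"
    and t: "t \<in> {a..b}"
  shows "f a * (b - t) + f b * (t - a) \<le> f t * (b - a)"
proof -
  have "f a \<le> f t + f' t * (a - t)" "f b \<le> f t + f' t * (b - t)"
    using nonincreasing_deriv_tangent[OF der mono t] t by auto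
  then have "f a * (b - t) + f b * (t - a) \<le> (f t + f' t * (a - t)) * (b - t) + (f t + f' t * (b - t)) * (t - a)"
    using t by (intro add_mono mult_right_mono) auto
  then show ?thesis by (simp add: algebra_simps)
qed

section \<open>Truncated powers and the series for \<open>r\<close>\<close>

definition pos_power :: "nat \<Rightarrow> real \<Rightarrow> real" where
  "pos_power m s = max 0 s ^ m / fact m"

lemma pos_power_nonpos: "s \<le> 0 \<Longrightarrow> 0 < m \<Longrightarrow> pos_power m s = 0"
  by (simp add: pos_power_def max_def)

lemma pos_power_bound: "s \<le> \<bar>t\<bar> \<Longrightarrow> \<bar>pos_power m s\<bar> \<le> \<bar>t\<bar> ^ m / fact m"
  by (auto simp: pos_power_def abs_mult power_abs intro!: divide_right_mono power_mono)

text \<open>For \<open>m = 0\<close> nothing two-sided can hold at the origin: since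
  \<open>0 ^ 0 = 1\<close>, \<open>pos_power 0\<close> is constantly one, while
  \<open>pos_power 1\<close> has a kink there.\<close>

lemma pos_power_deriv_Ici:
  assumes "0 \<le> s"
  shows "(pos_power (Suc m) has_real_derivative pos_power m s) (at s within {0..})"
proof -
  have "((\<lambda>s. s ^ Suc m / fact (Suc m)) has_real_derivative (real (Suc m) * s ^ m) / fact (Suc m)) (at s within {0..})"
    by (rule DERIV_cdivide) (use DERIV_pow[of "Suc m" s "{0..}"] in simp)
  also have "(real (Suc m) * s ^ m) / fact (Suc m) = pos_power m s"
    using assms by (simp add: pos_power_def max_def del: of_nat_Suc)
  finally show ?thesis
    by (rule has_field_derivative_transform_within[where d = 1]) (use assms in \<open>auto simp: pos_power_def max_def\<close>)
qed

text \<open>From exponent two on the kink disappears, as the difference quotient at the origin is of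
  order \<open>\<bar>h\<bar> ^ Suc m\<close>.\<close>

lemma pos_power_deriv: "(pos_power (Suc (Suc m)) has_real_derivative pos_power (Suc m) s) (at s)"
proof -
  consider "0 < s" | "s < 0" | "s = 0" by linarith
  then show ?thesis
  proof cases
    case 1
    then have "(pos_power (Suc (Suc m)) has_real_derivative pos_power (Suc m) s) (at s within {0..})"
      by (intro pos_power_deriv_Ici) simp
    moreover have "at s within {0..} = at s" using 1 by (intro at_within_interior) simp
    ultimately show ?thesis by simp
  next
    case 2
    have "((\<lambda>_. 0) has_real_derivative 0) (at s)" by simp
    then have "(pos_power (Suc (Suc m)) has_real_derivative 0) (at s)"
      by (rule has_field_derivative_transform_within_open[where S = "{..<0}"]) (use 2 in \<open>auto simp: pos_power_nonpos\<close>)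
    then show ?thesis using 2 by (simp add: pos_power_nonpos)
  next
    case 3
    have "((\<lambda>h. pos_power (Suc (Suc m)) h / h) \<longlongrightarrow> 0) (at 0)"
    proof (rule Lim_null_comparison[OF always_eventually])
      show "\<forall>h. norm (pos_power (Suc (Suc m)) h / h) \<le> \<bar>h\<bar> ^ Suc m / fact (Suc (Suc m))"
      proof
        fix h :: real
        have "\<bar>pos_power (Suc (Suc m)) h\<bar> \<le> \<bar>h\<bar> ^ Suc (Suc m) / fact (Suc (Suc m))"
          by (intro pos_power_bound) simp
        then show "norm (pos_power (Suc (Suc m)) h / h) \<le> \<bar>h\<bar> ^ Suc m / fact (Suc (Suc m))"
          by (cases "h = 0") (simp_all add: field_simps del: fact_Suc)
      qed
      show "((\<lambda>h::real. \<bar>h\<bar> ^ Suc m / fact (Suc (Suc m))) \<longlongrightarrow> 0) (at 0)"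
        by (auto intro!: tendsto_eq_intros simp del: fact_Suc)
    qed
    then show ?thesis using 3 by (simp add: DERIV_def pos_power_nonpos)
  qed
qed

text \<open>Integrating the equation step by step expresses \<open>r \<Delta> t\<close> as one plus the sum over \<open>k\<close> of
  \<open>(-1) ^ (k + 1) * max 0 (t - k * \<Delta>) ^ (2 * k + 2) / fact (2 * k + 2)\<close>; the index \<open>i\<close> below is \<open>2\<close>
  for this series, and \<open>1\<close> and \<open>0\<close> for its first and second derivatives.\<close>

definition r_term :: "real \<Rightarrow> nat \<Rightarrow> nat \<Rightarrow> real \<Rightarrow> real" where
  "r_term \<Delta> i k t = (-1) ^ Suc k * pos_power (2 * k + i) (t - real k * \<Delta>)"

text \<open>Dropping the shift by \<open>k * \<Delta>\<close> only enlarges the truncated power and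
  leaves a term of the exponential series, uniformly for bounded \<open>t\<close>.\<close>

lemma r_term_bound:
  assumes "0 \<le> \<Delta>" "\<bar>t\<bar> \<le> T"
  shows "norm (r_term \<Delta> i k t) \<le> T ^ (2 * k + i) / fact (2 * k + i)"
proof -
  have "\<bar>pos_power (2 * k + i) (t - real k * \<Delta>)\<bar> \<le> \<bar>T\<bar> ^ (2 * k + i) / fact (2 * k + i)"
    using assms by (intro pos_power_bound) (smt (verit) mult_nonneg_nonneg of_nat_0_le_iff)
  then show ?thesis using assms by (simp add: r_term_def abs_mult power_abs)
qed

lemma summable_exp_reindex:
  assumes "0 \<le> (T::real)"
  shows "summable (\<lambda>k. T ^ (2 * k + i) / fact (2 * k + i))"
proof -
  have "summable (\<lambda>n. T ^ n / fact n)" using summable_exp_generic[of T] by (simp add: field_simps)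
  then have "summable ((\<lambda>n. T ^ n / fact n) \<circ> (\<lambda>k. 2 * k + i))"
    by (rule summable_reindex) (use assms in \<open>auto simp: inj_on_def\<close>)
  then show ?thesis by (simp add: o_def)
qed

lemma r_term_summable: "0 \<le> \<Delta> \<Longrightarrow> summable (\<lambda>k. r_term \<Delta> i k t)"
  by (rule summable_comparison_test'[OF summable_exp_reindex[of "\<bar>t\<bar>" i]])
    (rule abs_ge_zero, rule r_term_bound, simp_all)

lemma r_term_uniform:
  assumes "0 \<le> \<Delta>" "0 \<le> T" "S \<subseteq> {-T..T}"
  shows "uniform_limit S (\<lambda>n t. \<Sum>k<n. r_term \<Delta> i k t) (\<lambda>t. \<Sum>k. r_term \<Delta> i k t) sequentially"
  by (rule Weierstrass_m_test[OF _ summable_exp_reindex[OF \<open>0 \<le> T\<close>, of i]])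
    (use assms in \<open>force intro!: r_term_bound\<close>)

text \<open>The one excluded term, with \<open>i = 0\<close> and \<open>k = 0\<close>, has exponent
  one and a kink at the origin.\<close>

lemma r_term_deriv:
  assumes "0 < i \<or> 0 < k"
  shows "(r_term \<Delta> (Suc i) k has_real_derivative r_term \<Delta> i k t) (at t within S)"
proof -
  obtain m where m: "2 * k + i = Suc m" using assms by (cases "2 * k + i") auto
  show ?thesis
    unfolding r_term_def using m
    by (auto intro!: derivative_eq_intros DERIV_chain2[OF pos_power_deriv] has_field_derivative_at_within[where s=S])
qed

lemma r_term_deriv_Ici:
  assumes "0 \<le> t" "S \<subseteq> {0..}"
  shows "(r_term \<Delta> (Suc i) k has_real_derivative r_term \<Delta> i k t) (at t within S)"
proof (cases "0 < i \<or> 0 < k")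
  case False
  have "(pos_power (Suc 0) has_real_derivative pos_power 0 t) (at t within S)"
    using pos_power_deriv_Ici[OF assms(1)] assms(2) by (rule DERIV_subset)
  from DERIV_minus[OF this] show ?thesis using False by (simp add: r_term_def[abs_def])
qed (rule r_term_deriv)

definition r_sum :: "real \<Rightarrow> nat \<Rightarrow> real \<Rightarrow> real" where
  "r_sum \<Delta> i t = (\<Sum>k. r_term \<Delta> i k t)"

lemma r_sum_deriv:
  assumes "0 \<le> \<Delta>"
  shows "(r_sum \<Delta> (Suc (Suc i)) has_real_derivative r_sum \<Delta> (Suc i) t) (at t)"
proof -
  define T where "T = \<bar>t\<bar> + 1"
  show ?thesis
    unfolding r_sum_def[abs_def]
  proof (rule has_field_derivative_series'[where S = "{-T..T}"])
    show "uniformly_convergent_on {-T..T} (\<lambda>n t. \<Sum>k<n. r_term \<Delta> (Suc i) k t)"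
      using r_term_uniform[OF assms, of T "{-T..T}"] by (auto simp: uniformly_convergent_on_def T_def)
    show "0 \<in> {-T..T}" "t \<in> interior {-T..T}" by (auto simp: T_def)
  qed (auto intro: r_term_deriv r_term_summable assms)
qed

text \<open>For \<open>i = 0\<close> the series contains the term with the kink, so it is
  differentiated on \<open>{0..T}\<close> only; \<open>T = t + 1\<close> keeps \<open>t\<close> away
  from the right end, so that the derivative within \<open>{0..T}\<close> is the one within
  \<open>{0..}\<close>.\<close>

lemma r_sum_deriv_Ici:
  assumes "0 \<le> \<Delta>" "0 \<le> t"
  shows "(r_sum \<Delta> (Suc i) has_real_derivative r_sum \<Delta> i t) (at t within {0..})"
proof -
  define T where "T = t + 1"
  have "\<exists>g. \<forall>s\<in>{0..T}. (\<lambda>k. r_term \<Delta> (Suc i) k s) sums g s \<and> (g has_real_derivative r_sum \<Delta> i s) (at s within {0..T})"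
  proof (rule has_field_derivative_series)
    show "uniform_limit {0..T} (\<lambda>n t. \<Sum>k<n. r_term \<Delta> i k t) (r_sum \<Delta> i) sequentially"
      unfolding r_sum_def[abs_def] using assms by (intro r_term_uniform[of _ T]) (auto simp: T_def)
    show "0 \<in> {0..T}" using assms by (simp add: T_def)
  qed (auto intro: r_term_deriv_Ici r_term_summable assms)
  then obtain g where g: "\<And>s. s \<in> {0..T} \<Longrightarrow> g s = r_sum \<Delta> (Suc i) s"
    "\<And>s. s \<in> {0..T} \<Longrightarrow> (g has_real_derivative r_sum \<Delta> i s) (at s within {0..T})"
    unfolding r_sum_def by (metis sums_unique)
  have t: "t \<in> {0..T}" using assms by (simp add: T_def)
  have "(r_sum \<Delta> (Suc i) has_real_derivative r_sum \<Delta> i t) (at t within {0..T})"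
    by (rule has_field_derivative_transform_within[OF g(2)[OF t], where d = 1]) (use t g(1) in auto)
  moreover have "at t within {0..T} = at t within {0..}"
    by (rule at_within_nhd[of _ "{..<T}"]) (use t in \<open>auto simp: T_def\<close>)
  ultimately show ?thesis by simp
qed

lemma is_r_exists:
  assumes "0 \<le> \<Delta>"
  shows "is_r \<Delta> (\<lambda>t. 1 + r_sum \<Delta> 2 t)"
proof -
  have zero: "r_sum \<Delta> i t = 0" if "t \<le> 0" "0 < i" for i t
  proof -
    have "t - real k * \<Delta> \<le> 0" for k using that(1) assms by (smt (verit) mult_nonneg_nonneg of_nat_0_le_iff)
    then show ?thesis using that(2) by (simp add: r_sum_def r_term_def pos_power_nonpos)
  qed
  have "r_sum \<Delta> 0 t = - (1 + r_sum \<Delta> 2 (t - \<Delta>))" if "0 \<le> t" for t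
  proof -
    \<comment> \<open>Shifting the index moves one delay into the argument and raises the order by
      two; with the term -1 left over at index 0 this reproduces the delay equation.\<close>
    have "r_term \<Delta> 0 (Suc k) t = - r_term \<Delta> 2 k (t - \<Delta>)" for k
      by (simp add: r_term_def algebra_simps)
    then have "(\<Sum>k. r_term \<Delta> 0 (Suc k) t) = - r_sum \<Delta> 2 (t - \<Delta>)"
      using suminf_minus[OF r_term_summable[OF assms]] by (simp add: r_sum_def)
    moreover have "r_term \<Delta> 0 0 t = -1" by (simp add: r_term_def pos_power_def)
    ultimately show ?thesis
      using suminf_split_head[OF r_term_summable[OF assms, of 0 t]] by (simp add: r_sum_def)
  qed
  then have "((r_sum \<Delta> 1) has_real_derivative - (1 + r_sum \<Delta> 2 (t - \<Delta>))) (at t within {0..})" if "0 \<le> t" for t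
    using r_sum_deriv_Ici[OF assms that, of 0] that by simp
  moreover have "((\<lambda>t. 1 + r_sum \<Delta> 2 t) has_real_derivative r_sum \<Delta> 1 t) (at t)" for t
    using DERIV_add[OF DERIV_const[of 1] r_sum_deriv[OF assms, of 0 t]] by (simp add: numeral_2_eq_2)
  ultimately show ?thesis unfolding is_r_def using zero by (auto intro!: exI[of _ "r_sum \<Delta> 1"])
qed

text \<open>The half-line is covered in steps of length 1/2. If the difference \<open>d\<close>
  vanishes up to \<open>a\<close> and has maximal modulus m on the next step, then |d'| is at most
  m/2 and |d| at most m/4 there, whence m = 0. The step length does not depend on the delay, so
  \<open>\<Delta> = 0\<close> is covered as well.\<close>

lemma is_r_unique:
  assumes "0 \<le> \<Delta>" "is_r \<Delta> f" "is_r \<Delta> h"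
  shows "f = h"
proof -
  obtain f' where f: "\<And>t. t \<le> 0 \<Longrightarrow> f t = 1" "\<And>t. (f has_real_derivative f' t) (at t)"
    "\<And>t. 0 \<le> t \<Longrightarrow> (f' has_real_derivative - f (t - \<Delta>)) (at t within {0..})"
    using assms(2) unfolding is_r_def by blast
  obtain h' where h: "\<And>t. t \<le> 0 \<Longrightarrow> h t = 1" "\<And>t. (h has_real_derivative h' t) (at t)"
    "\<And>t. 0 \<le> t \<Longrightarrow> (h' has_real_derivative - h (t - \<Delta>)) (at t within {0..})"
    using assms(3) unfolding is_r_def by blast
  define d where "d t = f t - h t" for t
  define d' where "d' t = f' t - h' t" for t
  have d: "(d has_real_derivative d' t) (at t)" for t
    unfolding d_def[abs_def] d'_def by (intro DERIV_diff f h)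
  have d2: "(d' has_real_derivative - d (t - \<Delta>)) (at t within {0..})" if "0 \<le> t" for t
    using DERIV_diff[OF f(3)[OF that] h(3)[OF that]] by (simp add: d_def d'_def[abs_def])
  have dcont: "continuous_on S d" for S
    using d by (intro continuous_at_imp_continuous_on) (auto intro: DERIV_isCont)
  have "d t = 0" if "t \<le> real n / 2" for n t
    using that
  proof (induction n arbitrary: t)
    case 0
    then show ?case using f(1)[of t] h(1)[of t] by (simp add: d_def)
  next
    case (Suc n)
    define a where "a = real n / 2"
    have "0 \<le> a" by (simp add: a_def)
    have d0: "d s = 0" if "s \<le> a" for s using Suc.IH that by (simp add: a_def)
    \<comment> \<open>As \<open>d\<close> vanishes to the left of \<open>a\<close>, its two-sided
      derivative must agree with the left derivative 0.\<close>
    have d'a: "d' a = 0"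
    proof (rule has_field_derivative_unique)
      show "(d has_real_derivative d' a) (at a within {..a})" using d by (rule has_field_derivative_at_within)
      show "(d has_real_derivative 0) (at a within {..a})"
        by (rule has_field_derivative_transform_within[OF DERIV_const[of 0], where d = 1]) (auto simp: d0)
      show "at a within {..a} \<noteq> bot"
        using trivial_limit_at_left_real[of a] at_le[of "{..<a}" "{..a}" a] le_bot by fastforce
    qed
    obtain s where s: "s \<in> {a..a+1/2}" "\<And>t. t \<in> {a..a+1/2} \<Longrightarrow> \<bar>d t\<bar> \<le> \<bar>d s\<bar>"
      using continuous_attains_sup[of "{a..a+1/2}" "\<lambda>t. \<bar>d t\<bar>"] continuous_on_rabs[OF dcont] by auto
    have M: "\<bar>d t\<bar> \<le> \<bar>d s\<bar>" if "t \<le> a + 1/2" for t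
      using s(2)[of t] d0[of t] that by (cases "t \<le> a") auto
    have d'_bound: "\<bar>d' t\<bar> \<le> \<bar>d s\<bar> / 2" if t: "t \<in> {a..a+1/2}" for t
    proof -
      have "norm (d' t - d' a) \<le> \<bar>d s\<bar> * norm (t - a)"
      proof (rule field_differentiable_bound[of "{a..a+1/2}" d' "\<lambda>u. - d (u - \<Delta>)"])
        fix u assume u: "u \<in> {a..a+1/2}"
        show "(d' has_real_derivative - d (u - \<Delta>)) (at u within {a..a+1/2})"
          using u \<open>0 \<le> a\<close> by (intro DERIV_subset[OF d2]) auto
        show "norm (- d (u - \<Delta>)) \<le> \<bar>d s\<bar>" using M[of "u - \<Delta>"] u assms(1) by simp
      qed (use t in auto)
      also have "\<dots> \<le> \<bar>d s\<bar> * (1/2)" using t by (intro mult_left_mono) auto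
      finally show ?thesis by (simp add: d'a)
    qed
    have "norm (d s - d a) \<le> \<bar>d s\<bar> / 2 * norm (s - a)"
      by (rule field_differentiable_bound[of "{a..a+1/2}" d d'])
        (use s(1) d d'_bound in \<open>auto intro: has_field_derivative_at_within\<close>)
    also have "\<dots> \<le> \<bar>d s\<bar> / 2 * (1/2)" using s(1) by (intro mult_left_mono) auto
    finally have "d s = 0" by (simp add: d0)
    then show ?case using M[of t] Suc.prems by (simp add: a_def field_simps)
  qed
  moreover have "\<exists>n. t \<le> real n / 2" for t
    using real_arch_simple[of "2 * t"] by (auto simp: field_simps)
  ultimately have "d t = 0" for t by blast
  then show ?thesis by (auto simp: d_def)
qed

section \<open>The first zero of \<open>r\<close> and its concavity up to there\<close>

lemma is_r_r: "0 \<le> \<Delta> \<Longrightarrow> is_r \<Delta> (r \<Delta>)"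
  unfolding r_def by (rule theI[of _ "\<lambda>t. 1 + r_sum \<Delta> 2 t"]) (auto intro: is_r_exists is_r_unique)

text \<open>Without a zero, \<open>r\<close> would stay positive, \<open>r'\<close> would decrease
  from 0 to a negative value at 1, and the graph would lie below a descending tangent. The zeros up
  to a given one form a compact set, so that \<open>LEAST\<close> is attained.\<close>

lemma r_first_zero:
  assumes "0 \<le> \<Delta>"
  shows "0 < \<theta> \<Delta>" "r \<Delta> (\<theta> \<Delta>) = 0" "\<And>t. t < \<theta> \<Delta> \<Longrightarrow> 0 < r \<Delta> t"
proof -
  obtain r' where r: "\<And>t. t \<le> 0 \<Longrightarrow> r \<Delta> t = 1" "\<And>t. (r \<Delta> has_real_derivative r' t) (at t)" "r' 0 = 0"
    "\<And>t. 0 \<le> t \<Longrightarrow> (r' has_real_derivative - r \<Delta> (t - \<Delta>)) (at t within {0..})"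
    using is_r_r[OF assms] unfolding is_r_def by blast
  have cont: "continuous_on S (r \<Delta>)" for S
    using r(2) by (intro continuous_at_imp_continuous_on) (auto intro: DERIV_isCont)
  have zero_between: "\<exists>s. 0 \<le> s \<and> s \<le> t \<and> r \<Delta> s = 0" if "0 \<le> t" "r \<Delta> t \<le> 0" for t
    using IVT2'[of "r \<Delta>" t 0 0] that r(1)[of 0] cont by auto
  have "\<exists>t>0. r \<Delta> t = 0"
  proof (rule ccontr)
    assume no_zero: "\<not> (\<exists>t>0. r \<Delta> t = 0)"
    have pos: "0 < r \<Delta> t" for t
    proof (rule ccontr)
      assume neg: "\<not> 0 < r \<Delta> t"
      then have "0 < t" using r(1)[of t] by (cases "t \<le> 0") auto
      then obtain s where "0 \<le> s" "r \<Delta> s = 0" using zero_between[of t] neg by auto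
      then show False using no_zero r(1)[of 0] by (cases "s = 0") auto
    qed
    have r'_mono: "r' t \<le> r' s" if "0 \<le> s" "s \<le> t" for s t
      by (rule nonincreasing_of_deriv[OF that(2)]) (use that pos in \<open>auto intro: DERIV_subset[OF r(4)] less_imp_le\<close>)
    have "r' 1 < r' 0"
    proof (rule DERIV_neg_imp_decreasing_open[of 0 1 r'])
      show "(0::real) < 1" by simp
      fix t :: real assume t: "0 < t" "t < 1"
      then have "(r' has_real_derivative - r \<Delta> (t - \<Delta>)) (at t)"
        using r(4)[of t] at_within_interior[of t "{0..}"] by simp
      then show "\<exists>y. (r' has_real_derivative y) (at t) \<and> y < 0" using pos by force
    next
      show "continuous_on {0..1} r'" by (rule DERIV_continuous_on[OF DERIV_subset[OF r(4)]]) auto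
    qed
    then have neg: "r' 1 < 0" by (simp add: r(3))
    \<comment> \<open>This is where the tangent at 1 meets the axis.\<close>
    define t where "t = 1 - r \<Delta> 1 / r' 1"
    have "1 \<le> t" using neg pos[of 1] by (simp add: t_def divide_nonneg_neg less_imp_le divide_nonneg_nonpos)
    have "r \<Delta> t \<le> r \<Delta> 1 + r' 1 * (t - 1)"
      by (rule nonincreasing_deriv_tangent[of 1 t]) (use \<open>1 \<le> t\<close> r'_mono r(2) in \<open>auto intro: has_field_derivative_at_within\<close>)
    also have "\<dots> = 0" using neg by (simp add: t_def)
    finally show False using pos[of t] by simp
  qed
  then obtain t0 where t0: "0 < t0" "r \<Delta> t0 = 0" by blast
  have "compact ({0..t0} \<inter> (r \<Delta> -` {0}))"
    using r(2) by (intro compact_Int_closed continuous_closed_vimage) (auto intro: DERIV_isCont)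
  moreover have "t0 \<in> {0..t0} \<inter> (r \<Delta> -` {0})" using t0 by simp
  then have "{0..t0} \<inter> (r \<Delta> -` {0}) \<noteq> {}" by blast
  ultimately obtain m where m: "m \<in> {0..t0} \<inter> (r \<Delta> -` {0})" "\<And>t. t \<in> {0..t0} \<inter> (r \<Delta> -` {0}) \<Longrightarrow> m \<le> t"
    using continuous_attains_inf[of "{0..t0} \<inter> (r \<Delta> -` {0})" "\<lambda>t. t"] continuous_on_id by blast
  have "m \<noteq> 0" using m(1) r(1)[of 0] by auto
  then have "0 < m" using m(1) by auto
  have least: "m \<le> t" if "0 \<le> t" "r \<Delta> t = 0" for t
    using m(2)[of t] m(1) that by (cases "t \<le> t0") auto
  have \<theta>: "\<theta> \<Delta> = m"
    unfolding \<theta>_def by (rule Least_equality) (use \<open>0 < m\<close> m(1) least in auto)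
  show "0 < \<theta> \<Delta>" "r \<Delta> (\<theta> \<Delta>) = 0" using \<theta> m(1) \<open>0 < m\<close> by auto
  show "0 < r \<Delta> t" if "t < \<theta> \<Delta>" for t
  proof (rule ccontr)
    assume "\<not> 0 < r \<Delta> t"
    moreover from this have "0 \<le> t" using r(1)[of t] by (cases "t \<le> 0") auto
    ultimately obtain s where "0 \<le> s" "s \<le> t" "r \<Delta> s = 0" using zero_between[of t] by auto
    then show False using least[of s] that \<theta> by simp
  qed
qed

text \<open>Up to \<open>\<theta> \<Delta>\<close> the delayed values of \<open>r\<close> are
  nonnegative, so the equation makes \<open>r'\<close> nonincreasing there.\<close>

lemma r_derivative:
  assumes "0 \<le> \<Delta>"
  obtains r' where "\<And>t. (r \<Delta> has_real_derivative r' t) (at t)"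
    and "\<And>t. 0 \<le> t \<Longrightarrow> (r' has_real_derivative - r \<Delta> (t - \<Delta>)) (at t within {0..})"
    and "\<And>s t. 0 \<le> s \<Longrightarrow> s \<le> t \<Longrightarrow> t \<le> \<theta> \<Delta> \<Longrightarrow> r' t \<le> r' s"
    and "r' 0 = 0"
proof -
  obtain r' where r: "\<And>t. (r \<Delta> has_real_derivative r' t) (at t)" "r' 0 = 0"
    "\<And>t. 0 \<le> t \<Longrightarrow> (r' has_real_derivative - r \<Delta> (t - \<Delta>)) (at t within {0..})"
    using is_r_r[OF assms] unfolding is_r_def by blast
  have nonneg: "0 \<le> r \<Delta> t" if "t \<le> \<theta> \<Delta>" for t
    using r_first_zero[OF assms] that by (cases "t = \<theta> \<Delta>") (auto simp: less_le)
  show thesis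
  proof (rule that[OF r(1,3) _ r(2)])
    fix s t assume "0 \<le> s" "s \<le> t" "t \<le> \<theta> \<Delta>"
    then show "r' t \<le> r' s"
      using nonneg assms
      by (intro nonincreasing_of_deriv[of s t r' "\<lambda>t. - r \<Delta> (t - \<Delta>)"] DERIV_subset[OF r(3)]) auto
  qed
qed

lemma r_nonpos: "0 \<le> \<Delta> \<Longrightarrow> t \<le> 0 \<Longrightarrow> r \<Delta> t = 1"
  using is_r_r by (auto simp: is_r_def)

lemma r_antimono:
  assumes "0 \<le> \<Delta>" "s \<le> t" "t \<le> \<theta> \<Delta>"
  shows "r \<Delta> t \<le> r \<Delta> s"
proof -
  obtain r' where r: "\<And>t. (r \<Delta> has_real_derivative r' t) (at t)"
    "\<And>s t. 0 \<le> s \<Longrightarrow> s \<le> t \<Longrightarrow> t \<le> \<theta> \<Delta> \<Longrightarrow> r' t \<le> r' s" "r' 0 = 0"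
    using r_derivative[OF assms(1)] by metis
  have *: "r \<Delta> t \<le> r \<Delta> s" if "0 \<le> s" "s \<le> t" "t \<le> \<theta> \<Delta>" for s t
  proof (rule nonincreasing_of_deriv[of s t "r \<Delta>" r'])
    show "r' u \<le> 0" if "u \<in> {s..t}" for u
      using r(2)[of 0 u] r(3) that \<open>0 \<le> s\<close> \<open>t \<le> \<theta> \<Delta>\<close> by simp
  qed (use that r(1) in \<open>auto intro: has_field_derivative_at_within\<close>)
  have "r \<Delta> t \<le> r \<Delta> (max 0 s)"
    using *[of "max 0 s" t] assms r_nonpos[of \<Delta> t] r_nonpos[of \<Delta> 0] by (cases "0 \<le> t") auto
  also have "\<dots> = r \<Delta> s" using r_nonpos[of \<Delta>] assms(1) by (simp add: max_def)
  finally show ?thesis .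
qed

lemma r_nonneg: "0 \<le> \<Delta> \<Longrightarrow> t \<le> \<theta> \<Delta> \<Longrightarrow> 0 \<le> r \<Delta> t"
  using r_antimono[of \<Delta> t "\<theta> \<Delta>"] r_first_zero(2)[of \<Delta>] by simp

lemma continuous_on_r: "0 \<le> \<Delta> \<Longrightarrow> continuous_on S (r \<Delta>)"
  using is_r_r[of \<Delta>] by (auto simp: is_r_def intro!: continuous_at_imp_continuous_on intro: DERIV_isCont)

section \<open>The solution before time zero\<close>

text \<open>Write \<open>R s = \<rho> * r \<Delta> (\<theta> \<Delta> + s)\<close>. If \<open>\<bar>x\<bar> \<le> k * R\<close> with \<open>k \<ge> 1\<close>, then \<open>k * R - x\<close> and \<open>k * R + x\<close> are concave on
  \<open>[-\<theta> \<Delta>, 0]\<close>, vanish at \<open>0\<close> and are at least \<open>(k - 1) * \<rho>\<close> at \<open>-\<theta> \<Delta>\<close>. The chord bound then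
  improves \<open>k - 1\<close> by a fixed factor \<open>1 - c < 1\<close>, so that iteration gives \<open>k = 1\<close>.\<close>

lemma prehistory_bound:
  assumes "0 \<le> M" "M \<le> \<Delta>" "0 < \<rho>"
    and x: "\<And>t. - \<theta> \<Delta> - M \<le> t \<Longrightarrow> (x has_real_derivative x' t) (at t within {- \<theta> \<Delta> - M..})"
    and ac: "abs_cont_on_interval x' (- \<theta> \<Delta>) 0" and N: "negligible N"
    and eq: "\<And>t. t \<in> {- \<theta> \<Delta>..0} - N \<Longrightarrow> \<exists>D u. (x' has_real_derivative D) (at t) \<and> \<bar>D\<bar> \<le> \<bar>x u\<bar> \<and>
      t - M \<le> u \<and> u \<le> t"
    and bound: "\<And>t. t \<in> {- \<theta> \<Delta> - M..0} \<Longrightarrow> \<bar>x t\<bar> \<le> \<rho>" and "x 0 = 0"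
    and s: "s \<in> {- \<theta> \<Delta> - M..0}"
  shows "\<bar>x s\<bar> \<le> \<rho> * r \<Delta> (\<theta> \<Delta> + s)"
proof -
  have "0 \<le> \<Delta>" using assms(1,2) by simp
  note \<theta> = r_first_zero[OF \<open>0 \<le> \<Delta>\<close>]
  define R where "R s = \<rho> * r \<Delta> (\<theta> \<Delta> + s)" for s
  have R_nonneg: "0 \<le> R s" if "s \<le> 0" for s
    using r_nonneg[OF \<open>0 \<le> \<Delta>\<close>] that \<open>0 < \<rho>\<close> by (simp add: R_def)
  have R_left: "R s = \<rho>" if "s \<le> - \<theta> \<Delta>" for s
    using that r_nonpos[OF \<open>0 \<le> \<Delta>\<close>] by (simp add: R_def)
  obtain r' where r: "\<And>t. (r \<Delta> has_real_derivative r' t) (at t)"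
      "\<And>t. 0 \<le> t \<Longrightarrow> (r' has_real_derivative - r \<Delta> (t - \<Delta>)) (at t within {0..})"
      "\<And>s t. 0 \<le> s \<Longrightarrow> s \<le> t \<Longrightarrow> t \<le> \<theta> \<Delta> \<Longrightarrow> r' t \<le> r' s"
    using r_derivative[OF \<open>0 \<le> \<Delta>\<close>] by metis
  have x_Icc: "(x has_real_derivative x' t) (at t within {- \<theta> \<Delta>..0})" if "t \<in> {- \<theta> \<Delta>..0}" for t
    using that \<open>0 \<le> M\<close> by (intro DERIV_subset[OF x]) auto
  \<comment> \<open>Concavity puts \<open>r\<close> above its chord from (0, 1) to
    (\<open>\<theta> \<Delta>\<close>, 0). This bounds \<open>R\<close> from below by a linear
    function near its zero; \<open>R_lip\<close> bounds it from above.\<close>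
  have r_chord: "- s \<le> \<theta> \<Delta> * r \<Delta> (\<theta> \<Delta> + s)" if "s \<in> {- \<theta> \<Delta>..0}" for s
    using nonincreasing_deriv_chord[of 0 "\<theta> \<Delta>" "r \<Delta>" r' "\<theta> \<Delta> + s"] r(1,3) that \<theta>(2) r_nonpos[OF \<open>0 \<le> \<Delta>\<close>, of 0]
    by (auto intro: has_field_derivative_at_within simp: mult.commute)
  have "continuous_on {0..\<theta> \<Delta>} r'" by (rule DERIV_continuous_on[OF DERIV_subset[OF r(2)]]) auto
  then obtain L where L: "0 \<le> L"
    "\<And>s t. s \<in> {0..\<theta> \<Delta>} \<Longrightarrow> t \<in> {0..\<theta> \<Delta>} \<Longrightarrow> \<bar>r \<Delta> s - r \<Delta> t\<bar> \<le> L * \<bar>s - t\<bar>"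
    using C1_lipschitz[of 0 "\<theta> \<Delta>" "r \<Delta>" r'] r(1) has_field_derivative_at_within by metis
  have R_lip: "R s \<le> \<rho> * (L * - s)" if "s \<in> {- \<theta> \<Delta>..0}" for s
    unfolding R_def using L(2)[of "\<theta> \<Delta> + s" "\<theta> \<Delta>"] that \<theta>(1,2) \<open>0 < \<rho>\<close>
    by (intro mult_left_mono) (auto simp: abs_le_iff)
  have L\<theta>: "1 \<le> L * \<theta> \<Delta>"
    using L(2)[of 0 "\<theta> \<Delta>"] \<theta> r_nonpos[OF \<open>0 \<le> \<Delta>\<close>, of 0] by simp
  \<comment> \<open>For \<open>D = k * R - x\<close> or \<open>D = k * R + x\<close> the chord
    yields \<open>(k - 1) * \<rho> * (- s) \<le> D s * \<theta> \<Delta>\<close>; with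
    \<open>R_lip\<close> this becomes \<open>c * (k - 1) * R s \<le> D s\<close>, the gain of one
    round.\<close>
  define c where "c = 1 / (L * \<theta> \<Delta>)"
  have c: "0 < c" "c \<le> 1" using L\<theta> by (auto simp: c_def)
  have improve: "\<bar>x s\<bar> \<le> (1 + (1 - c) * (k - 1)) * R s"
    if k: "1 \<le> k" "\<And>s. s \<in> {- \<theta> \<Delta> - M..0} \<Longrightarrow> \<bar>x s\<bar> \<le> k * R s" and s: "s \<in> {- \<theta> \<Delta> - M..0}" for k s
  proof (cases "s \<le> - \<theta> \<Delta>")
    case True
    have "1 \<le> 1 + (1 - c) * (k - 1)" using c k(1) by simp
    then have "1 * R s \<le> (1 + (1 - c) * (k - 1)) * R s" using R_nonneg[of s] s by (intro mult_right_mono) auto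
    then show ?thesis using bound[OF s] R_left[OF True] by simp
  next
    case False
    then have s': "s \<in> {- \<theta> \<Delta>..0}" using s by auto
    have "\<sigma> * x s \<le> (1 + (1 - c) * (k - 1)) * R s" if \<sigma>: "\<sigma> = 1 \<or> \<sigma> = -1" for \<sigma> :: real
    proof -
      define D where "D t = k * R t - \<sigma> * x t" for t
      define D' where "D' t = k * (\<rho> * r' (\<theta> \<Delta> + t)) - \<sigma> * x' t" for t
      have "D (- \<theta> \<Delta>) * (0 - s) + D 0 * (s - (- \<theta> \<Delta>)) \<le> D s * (0 - (- \<theta> \<Delta>))"
      proof (rule nonincreasing_deriv_chord[OF _ _ s'])
        show "(D has_real_derivative D' t) (at t within {- \<theta> \<Delta>..0})" if "t \<in> {- \<theta> \<Delta>..0}" for t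
          unfolding D_def[abs_def] D'_def R_def using x_Icc[OF that]
          by (auto intro!: derivative_eq_intros DERIV_chain2[OF r(1)])
        show "D' t \<le> D' s" if st: "- \<theta> \<Delta> \<le> s" "s \<le> t" "t \<le> 0" for s t
        proof -
          \<comment> \<open>\<open>?G\<close> is minus the derivative of \<open>k * R\<close>. By
            the equation for \<open>r\<close>, its own derivative is
            \<open>k * R (t - \<Delta>)\<close>, the largest value of \<open>k * R\<close> on the
            delay window and hence a majorant of |x''|.\<close>
          let ?G = "\<lambda>t. - (k * (\<rho> * r' (\<theta> \<Delta> + t)))" and ?g = "\<lambda>t. k * R (t - \<Delta>)"
          have "- \<sigma> * x' t - (- \<sigma> * x' s) \<le> ?G t - ?G s"
          proof (rule abs_cont_increment_le[where g = ?g])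
            show "abs_cont_on_interval x' s t" using ac st(1,3) by (rule abs_cont_on_subinterval)
            show "(?G has_real_derivative ?g u) (at u within {s..t})" if u: "u \<in> {s..t}" for u
            proof -
              have "(r' has_real_derivative - r \<Delta> (\<theta> \<Delta> + u - \<Delta>)) (at (\<theta> \<Delta> + u) within (\<lambda>u. \<theta> \<Delta> + u) ` {s..t})"
                using u st by (intro DERIV_subset[OF r(2)]) auto
              moreover have "((\<lambda>u. \<theta> \<Delta> + u) has_real_derivative 1) (at u within {s..t})"
                by (auto intro!: derivative_eq_intros)
              ultimately have "((\<lambda>u. r' (\<theta> \<Delta> + u)) has_real_derivative - r \<Delta> (\<theta> \<Delta> + u - \<Delta>)) (at u within {s..t})"
                using DERIV_image_chain[of r' _ "\<lambda>u. \<theta> \<Delta> + u" u "{s..t}" 1] by (simp add: o_def)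
              from DERIV_cmult[OF this, of "- (k * \<rho>)"] show ?thesis
                by (simp add: R_def algebra_simps)
            qed
            show "continuous_on {s..t} ?g"
              unfolding R_def
              by (intro continuous_intros continuous_on_compose2[OF continuous_on_r[OF \<open>0 \<le> \<Delta>\<close>, of UNIV]]) auto
            show "\<exists>D. (x' has_real_derivative D) (at u) \<and> - \<sigma> * D \<le> ?g u" if u: "u \<in> {s..t} - N" for u
            proof -
              have "u \<in> {- \<theta> \<Delta>..0} - N" using u st by auto
              then obtain D v where D: "(x' has_real_derivative D) (at u)" "\<bar>D\<bar> \<le> \<bar>x v\<bar>" "u - M \<le> v" "v \<le> u"
                using eq by blast
              have "- \<sigma> * D \<le> \<bar>D\<bar>" using \<sigma> by auto
              also have "\<dots> \<le> \<bar>x v\<bar>" by (rule D(2))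
              also have "\<dots> \<le> k * R v" using D(3,4) u st by (intro k(2)) auto
              also have "\<dots> \<le> k * R (u - \<Delta>)"
                unfolding R_def using D(3,4) u st \<open>M \<le> \<Delta>\<close> k(1) \<open>0 < \<rho>\<close>
                by (intro mult_left_mono r_antimono[OF \<open>0 \<le> \<Delta>\<close>]) auto
              finally show ?thesis using D(1) by blast
            qed
          qed (use st N in auto)
          then show ?thesis by (simp add: D'_def)
        qed
      qed
      moreover have "D 0 = 0" using \<theta>(2) \<open>x 0 = 0\<close> by (simp add: D_def R_def)
      moreover have "(k - 1) * \<rho> \<le> D (- \<theta> \<Delta>)"
        using bound[of "- \<theta> \<Delta>"] \<theta>(1) \<open>0 \<le> M\<close> R_left[of "- \<theta> \<Delta>"] \<sigma> by (auto simp: D_def algebra_simps)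
      then have "(k - 1) * \<rho> * (- s) \<le> D (- \<theta> \<Delta>) * (0 - s)" using s by (simp add: mult_right_mono_neg)
      ultimately have *: "(k - 1) * \<rho> * (- s) \<le> D s * \<theta> \<Delta>" by simp
      have "(k - 1) * R s \<le> (k - 1) * (\<rho> * (L * - s))" using R_lip[OF s'] k(1) by (intro mult_left_mono) auto
      also have "\<dots> = L * ((k - 1) * \<rho> * (- s))" by simp
      also have "\<dots> \<le> L * (D s * \<theta> \<Delta>)" using * L(1) by (rule mult_left_mono)
      finally have "c * ((k - 1) * R s) \<le> c * (L * (D s * \<theta> \<Delta>))" using c(1) by (intro mult_left_mono) auto
      also have "\<dots> = D s" using L\<theta> by (auto simp: c_def)
      finally show ?thesis by (simp add: D_def algebra_simps)
    qed
    from this[of 1] this[of "-1"] show ?thesis by (simp add: abs_le_iff)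
  qed
  obtain L2 where L2: "0 \<le> L2"
    "\<And>s t. s \<in> {- \<theta> \<Delta>..0} \<Longrightarrow> t \<in> {- \<theta> \<Delta>..0} \<Longrightarrow> \<bar>x s - x t\<bar> \<le> L2 * \<bar>s - t\<bar>"
    using C1_lipschitz[OF x_Icc abs_cont_on_imp_continuous_on[OF ac]] by metis
  \<comment> \<open>Near 0, |x s| is at most \<open>L2 * (- s)\<close>, and by
    \<open>r_chord\<close> \<open>R s\<close> is at least
    \<open>\<rho> * (- s) / \<theta> \<Delta>\<close>; their ratio is the second entry. The entry 1
    covers the part left of \<open>- \<theta> \<Delta>\<close> and meets the condition
    \<open>1 \<le> k\<close> of the iteration.\<close>
  define k0 where "k0 = max 1 (L2 * \<theta> \<Delta> / \<rho>)"
  have base: "\<bar>x s\<bar> \<le> k0 * R s" if s: "s \<in> {- \<theta> \<Delta> - M..0}" for s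
  proof (cases "s \<le> - \<theta> \<Delta>")
    case True
    have "1 * R s \<le> k0 * R s" using R_nonneg[of s] s by (intro mult_right_mono) (auto simp: k0_def)
    then show ?thesis using bound[OF s] R_left[OF True] by simp
  next
    case False
    then have s': "s \<in> {- \<theta> \<Delta>..0}" using s by auto
    have "\<bar>x s\<bar> \<le> L2 * (- s)" using L2(2)[OF s', of 0] s' \<theta>(1) \<open>x 0 = 0\<close> by simp
    also have "\<dots> \<le> L2 * (\<theta> \<Delta> * r \<Delta> (\<theta> \<Delta> + s))" using r_chord[OF s'] L2(1) by (rule mult_left_mono)
    also have "\<dots> = L2 * \<theta> \<Delta> / \<rho> * R s" using \<open>0 < \<rho>\<close> by (simp add: R_def)
    also have "\<dots> \<le> k0 * R s" using R_nonneg[of s] s by (intro mult_right_mono) (auto simp: k0_def)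
    finally show ?thesis .
  qed
  have iter: "\<forall>s\<in>{- \<theta> \<Delta> - M..0}. \<bar>x s\<bar> \<le> (1 + (1 - c) ^ n * (k0 - 1)) * R s" for n
  proof (induction n)
    case 0
    then show ?case using base by simp
  next
    case (Suc n)
    have "1 \<le> 1 + (1 - c) ^ n * (k0 - 1)" using c by (simp add: k0_def)
    from improve[OF this] Suc show ?case by (simp add: mult.assoc)
  qed
  have "(\<lambda>n. (1 + (1 - c) ^ n * (k0 - 1)) * R s) \<longlonglongrightarrow> (1 + 0 * (k0 - 1)) * R s"
    using c by (intro tendsto_intros LIMSEQ_power_zero) auto
  then have "\<bar>x s\<bar> \<le> (1 + 0 * (k0 - 1)) * R s"
    by (rule LIMSEQ_le_const) (use iter s in blast)
  then show ?thesis by (simp add: R_def)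
qed

section \<open>Comparison of iterated integrals\<close>

definition iterated_integral :: "(real \<Rightarrow> real) \<Rightarrow> real \<Rightarrow> real" where
  "iterated_integral g w = integral {-w..0} (\<lambda>u. integral {-w..u} g)"

text \<open>Integration by parts. In the single integral \<open>w\<close> is only a limit of
  integration, so that monotonicity and continuity in \<open>w\<close> can be read off.\<close>

lemma iterated_integral_eq:
  assumes "0 \<le> w" "continuous_on {..0} g"
  shows "iterated_integral g w = integral {-w..0} (\<lambda>v. - v * g v)"
proof -
  have g: "continuous_on {-w..0} g" using assms(2) by (rule continuous_on_subset) auto
  let ?H = "\<lambda>u. integral {-w..u} g" and ?I = "\<lambda>t. integral {-w..t} (\<lambda>u. integral {-w..u} g)"
  have H: "(?H has_real_derivative g t) (at t within {-w..0})" if "t \<in> {-w..0}" for t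
    using integral_has_real_derivative[OF g that] .
  then have "continuous_on {-w..0} ?H" by (rule DERIV_continuous_on)
  then have I: "(?I has_real_derivative ?H t) (at t within {-w..0})" if "t \<in> {-w..0}" for t
    using integral_has_real_derivative that by blast
  have "((\<lambda>v. - v * g v) has_integral (?I 0 - 0 * ?H 0) - (?I (-w) - (-w) * ?H (-w))) {-w..0}"
  proof (rule fundamental_theorem_of_calculus)
    fix t assume t: "t \<in> {-w..0}"
    have "((\<lambda>t. ?I t - t * ?H t) has_real_derivative ?H t - (?H t + t * g t)) (at t within {-w..0})"
      using H[OF t] I[OF t] by (auto intro!: derivative_eq_intros)
    then show "((\<lambda>t. ?I t - t * ?H t) has_vector_derivative - t * g t) (at t within {-w..0})"
      by (simp add: has_real_derivative_iff_has_vector_derivative)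
  qed (use assms in simp)
  then show ?thesis by (intro trans[OF _ integral_unique[symmetric]]) (simp_all add: iterated_integral_def)
qed

lemma const_le_integral:
  fixes f :: "real \<Rightarrow> real"
  assumes "a \<le> b" "continuous_on {a..b} f" "\<And>t. t \<in> {a..b} \<Longrightarrow> c \<le> f t"
  shows "c * (b - a) \<le> integral {a..b} f"
proof -
  have "integral {a..b} (\<lambda>_. c) \<le> integral {a..b} f"
    using assms by (intro integral_le integrable_continuous_real) auto
  then show ?thesis using assms(1) by (simp add: mult.commute)
qed

lemma integral_subset_le_continuous:
  fixes f :: "real \<Rightarrow> real"
  assumes "a \<le> a'" "b' \<le> b" "continuous_on {a..b} f" "\<And>t. t \<in> {a..b} \<Longrightarrow> 0 \<le> f t"
  shows "integral {a'..b'} f \<le> integral {a..b} f"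
  using assms
  by (intro integral_subset_le integrable_continuous_real continuous_on_subset[OF assms(3)]) auto

lemma iterated_integral_strict_mono:
  assumes g: "continuous_on {..0} g" "\<And>v. v < 0 \<Longrightarrow> 0 < g v" and "0 \<le> w" "w < w'"
  shows "iterated_integral g w < iterated_integral g w'"
proof -
  let ?f = "\<lambda>v. - v * g v"
  have f: "continuous_on S ?f" if "S \<subseteq> {..0}" for S
    using continuous_on_subset[OF g(1) that] by (intro continuous_intros)
  have fpos: "0 < ?f v" if "v < 0" for v using g(2)[OF that] that by (simp add: mult_neg_pos)
  have "integral {-w'..0} ?f = integral {-w'..-w} ?f + integral {-w..0} ?f"
    using assms(3,4)
    by (intro Henstock_Kurzweil_Integration.integral_combine[symmetric] integrable_continuous_real f) auto
  moreover have "0 < integral {-w'..-w} ?f"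
  proof -
    \<comment> \<open>For \<open>w = 0\<close> the interval reaches the origin, where
      \<open>?f\<close> vanishes; stopping at \<open>m\<close> leaves a compact interval with a
      positive minimum.\<close>
    obtain m where m: "-w' < m" "m < -w" using dense[of "-w'" "-w"] assms(4) by auto
    obtain s where s: "s \<in> {-w'..m}" "\<And>t. t \<in> {-w'..m} \<Longrightarrow> ?f s \<le> ?f t"
      using continuous_attains_inf[of "{-w'..m}" ?f] f[of "{-w'..m}"] m assms(3) by auto
    have "0 < ?f s" by (rule fpos) (use s(1) m assms(3) in auto)
    then have "0 < ?f s * (m - (-w'))" by (rule mult_pos_pos) (use m in simp)
    also have "\<dots> \<le> integral {-w'..m} ?f" using m assms(3) s(2) by (intro const_le_integral f) auto
    also have "\<dots> \<le> integral {-w'..-w} ?f"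
    proof (rule integral_subset_le_continuous)
      show "0 \<le> ?f v" if "v \<in> {-w'..-w}" for v
        using that assms(3) fpos[of v] by (cases "v = 0") auto
      show "continuous_on {-w'..-w} ?f" using assms(3) by (intro f) auto
    qed (use m in auto)
    finally show ?thesis .
  qed
  ultimately show ?thesis using assms(3,4) iterated_integral_eq[OF _ g(1)] by simp
qed

lemma iterated_integral_eq_1_unique:
  assumes g: "continuous_on {..0} g" "\<And>v. v < 0 \<Longrightarrow> 0 < g v"
    and c: "0 < c" "\<And>v. v \<le> -c \<Longrightarrow> 1 \<le> g v"
  shows "\<exists>!w. 0 < w \<and> iterated_integral g w = 1"
proof -
  let ?f = "\<lambda>v. - v * g v"
  \<comment> \<open>On \<open>{-M..-c}\<close>, of length \<open>1 / c\<close>, the weighted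
    integrand is at least \<open>c\<close>, so this part alone contributes 1.\<close>
  define M where "M = c + 1 / c"
  have M: "c < M" using c by (simp add: M_def)
  have f: "continuous_on S ?f" if "S \<subseteq> {..0}" for S
    using continuous_on_subset[OF g(1) that] by (intro continuous_intros)
  have fnn: "0 \<le> ?f v" if "v \<le> 0" for v
    using that g(2)[of v] by (cases "v = 0") (auto simp: mult_nonpos_nonneg less_imp_le)
  have cont: "continuous_on {-M..0} (\<lambda>a. integral {a..0} ?f)"
    by (intro indefinite_integral_continuous_1' integrable_continuous_real f) auto
  have "1 = c * (-c - (-M))" using c by (simp add: M_def)
  also have "\<dots> \<le> integral {-M..-c} ?f"
  proof (rule const_le_integral)
    show "c \<le> - v * g v" if "v \<in> {-M..-c}" for v
      using mult_mono[of c "-v" 1 "g v"] that c by simp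
    show "continuous_on {-M..-c} ?f" using c by (intro f) auto
  qed (use M in simp)
  also have "\<dots> \<le> integral {-M..0} ?f"
  proof (rule integral_subset_le_continuous)
    show "continuous_on {-M..0} ?f" by (intro f) auto
    show "0 \<le> ?f v" if "v \<in> {-M..0}" for v using that fnn by simp
  qed (use c in auto)
  finally have "\<exists>a. -M \<le> a \<and> a \<le> 0 \<and> integral {a..0} ?f = 1"
    using M c by (intro IVT2' cont) auto
  then obtain a where a: "-M \<le> a" "a \<le> 0" "integral {a..0} ?f = 1" by blast
  then have "a \<noteq> 0" by auto
  then have "0 < - a \<and> iterated_integral g (- a) = 1" using a iterated_integral_eq[OF _ g(1), of "-a"] by simp
  moreover have "w = w'" if "0 < w \<and> iterated_integral g w = 1" "0 < w' \<and> iterated_integral g w' = 1" for w w'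
    using iterated_integral_strict_mono[OF g, of w w'] iterated_integral_strict_mono[OF g, of w' w] that
    by (cases w w' rule: linorder_cases) auto
  ultimately show ?thesis by blast
qed

text \<open>\<open>U'_incr\<close> is the inequality \<open>U'' \<ge> - g\<close> in integrated
  form, since \<open>U'\<close> need not be differentiable everywhere. \<open>U\<close> will be the
  reflected solution or a later \<open>\<beta>\<close>.\<close>

lemma iterated_integral_comparison:
  assumes g: "continuous_on {..0} g" "\<And>v. v < 0 \<Longrightarrow> 0 < g v"
    and w: "0 < w" "iterated_integral g w = 1" and "0 < A"
    and U: "\<And>v. v \<in> {-A..0} \<Longrightarrow> (U has_real_derivative U' v) (at v within {-A..0})"
    and U'_incr: "\<And>s t. -A \<le> s \<Longrightarrow> s \<le> t \<Longrightarrow> t \<le> 0 \<Longrightarrow> - integral {s..t} g \<le> U' t - U' s"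
    and bc: "U (-A) = 1" "U' (-A) = 0" "U 0 \<le> 0"
    and le1: "\<And>v. v \<in> {-A..0} \<Longrightarrow> U v \<le> 1"
  shows "w \<le> A" and "\<And>v. v \<in> {-w..0} \<Longrightarrow> U v \<le> 1 - integral {-w..v} (\<lambda>u. integral {-w..u} g)"
proof -
  define H where "H a u = integral {a..u} g" for a u
  define I where "I a t = integral {a..t} (H a)" for a t
  have gc: "continuous_on {a..0} g" for a using g(1) by (rule continuous_on_subset) auto
  have H: "(H a has_real_derivative g t) (at t within {a..0})" if "t \<in> {a..0}" for a t
    unfolding H_def using integral_has_real_derivative[OF gc that] .
  then have "continuous_on {a..0} (H a)" for a by (rule DERIV_continuous_on)
  then have I: "(I a has_real_derivative H a t) (at t within {a..0})" if "t \<in> {a..0}" for a t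
    unfolding I_def using integral_has_real_derivative that by blast
  have IJ: "iterated_integral g b = I (-b) 0" for b by (simp add: iterated_integral_def I_def H_def[abs_def])
  have "- U 0 - I (-A) 0 \<le> - U (-A) - I (-A) (-A)"
  proof (rule nonincreasing_of_deriv[of "-A" 0 "\<lambda>t. - U t - I (-A) t"])
    show "((\<lambda>t. - U t - I (-A) t) has_real_derivative - U' t - H (-A) t) (at t within {-A..0})"
      if "t \<in> {-A..0}" for t
      using U[OF that] I[OF that] by (auto intro!: derivative_eq_intros)
    show "- U' t - H (-A) t \<le> 0" if "t \<in> {-A..0}" for t
      using U'_incr[of "-A" t] that bc(2) by (simp add: H_def)
  qed (use \<open>0 < A\<close> in simp)
  then have "1 \<le> iterated_integral g A" using bc IJ by (simp add: I_def)
  then show wA: "w \<le> A"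
    using iterated_integral_strict_mono[OF g, of A w] w \<open>0 < A\<close> by fastforce
  show "U v \<le> 1 - integral {-w..v} (\<lambda>u. integral {-w..u} g)" if v: "v \<in> {-w..0}" for v
  proof -
    define D where "D t = 1 - I (-w) t - U t" for t
    have sub: "{-w..0} \<subseteq> {-A..0}" using wA by auto
    have "D (-w) * (0 - v) + D 0 * (v - (-w)) \<le> D v * (0 - (-w))"
    proof (rule nonincreasing_deriv_chord[OF _ _ v])
      show "(D has_real_derivative - H (-w) t - U' t) (at t within {-w..0})" if "t \<in> {-w..0}" for t
        unfolding D_def[abs_def] using I[OF that] DERIV_subset[OF U sub, of t] that sub
        by (auto intro!: derivative_eq_intros)
      show "- H (-w) t - U' t \<le> - H (-w) s - U' s" if "-w \<le> s" "s \<le> t" "t \<le> 0" for s t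
      proof -
        have "H (-w) s + integral {s..t} g = H (-w) t"
          unfolding H_def using that
          by (intro Henstock_Kurzweil_Integration.integral_combine integrable_continuous_real continuous_on_subset[OF g(1)]) auto
        then show ?thesis using U'_incr[of s t] that wA by simp
      qed
    qed
    \<comment> \<open>For \<open>w < A\<close> the value of \<open>U\<close> at \<open>-w\<close> is
      not prescribed; the bound by 1 suffices, because the iterated integral vanishes at its lower
      limit.\<close>
    moreover have "0 \<le> D (-w)" using le1[of "-w"] wA w by (simp add: D_def I_def)
    moreover have "0 \<le> D 0" using w bc(3) IJ by (simp add: D_def)
    ultimately have "0 \<le> D v * w" using v by (smt (verit) atLeastAtMost_iff mult_nonneg_nonneg)
    then have "0 \<le> D v" using w by (simp add: zero_le_mult_iff)
    then show ?thesis by (simp add: D_def I_def H_def[abs_def])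
  qed
qed

section \<open>The functions \<open>\<beta>\<close>\<close>

lemma double_integral_iterated_integral: "double_integral \<rho> \<Delta> b w 0 = iterated_integral (integrand \<rho> \<Delta> b) w"
  by (simp add: double_integral_def iterated_integral_def)

text \<open>The \<open>\<beta>\<close> functions vanish at the origin from the second one on, hence the strict inequality
  only on the open half-line.\<close>

definition profile :: "(real \<Rightarrow> real) \<Rightarrow> bool" where
  "profile b \<longleftrightarrow> continuous_on {..0} b \<and> (\<forall>s t. s \<le> t \<longrightarrow> t \<le> 0 \<longrightarrow> b t \<le> b s) \<and>
    (\<forall>v<0. 0 < b v) \<and> 0 \<le> b 0 \<and> (\<exists>c>0. \<forall>v\<le>-c. b v = 1)"

lemma profileD:
  assumes "profile b"
  shows "continuous_on {..0} b" "\<And>s t. s \<le> t \<Longrightarrow> t \<le> 0 \<Longrightarrow> b t \<le> b s" "\<And>v. v < 0 \<Longrightarrow> 0 < b v" "0 \<le> b 0"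
  using assms by (auto simp: profile_def)

lemma profile_nonneg: "profile b \<Longrightarrow> v \<le> 0 \<Longrightarrow> 0 \<le> b v"
  using profileD(3)[of b v] profileD(4)[of b] by (cases "v = 0") auto

lemma profile_le_1:
  assumes "profile b" "v \<le> 0"
  shows "b v \<le> 1"
proof -
  obtain c where "0 < c" "\<And>v. v \<le> -c \<Longrightarrow> b v = 1" using assms(1) by (auto simp: profile_def)
  then show ?thesis using profileD(2)[OF assms(1), of "min v (-c)" v] assms(2) by simp
qed

lemma integrand_ge: "b v \<le> integrand \<rho> \<Delta> b v"
  by (simp add: integrand_def)

lemma integrand_mono: "b v \<le> b' v \<Longrightarrow> integrand \<rho> \<Delta> b v \<le> integrand \<rho> \<Delta> b' v"
  by (auto simp: integrand_def)

text \<open>The jump of the indicator at \<open>-\<Delta>\<close> is harmless, because \<open>r \<Delta>\<close> vanishes at \<open>\<theta> \<Delta>\<close>.\<close>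

lemma integrand_continuous:
  assumes "0 \<le> \<Delta>" "profile b"
  shows "continuous_on {..0} (integrand \<rho> \<Delta> b)"
proof -
  have "continuous_on {..0} (\<lambda>v. max (b v) (\<rho> * r \<Delta> (\<theta> \<Delta> - max v (-\<Delta>) - \<Delta>)))"
    by (intro continuous_intros profileD(1)[OF assms(2)]
      continuous_on_compose2[OF continuous_on_r[OF assms(1), of UNIV]]) auto
  moreover have "integrand \<rho> \<Delta> b v = max (b v) (\<rho> * r \<Delta> (\<theta> \<Delta> - max v (-\<Delta>) - \<Delta>))" if "v \<in> {..0}" for v
    using that profile_nonneg[OF assms(2), of v] r_first_zero(2)[OF assms(1)]
    by (auto simp: integrand_def indicator_def max_def)
  ultimately show ?thesis by (subst continuous_on_cong[OF refl])
qed

lemma integrand_pos: "profile b \<Longrightarrow> v < 0 \<Longrightarrow> 0 < integrand \<rho> \<Delta> b v"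
  using profileD(3) integrand_ge by (rule less_le_trans)

lemma next_varpi:
  assumes "0 \<le> \<Delta>" "profile b"
  shows "0 < next_varpi \<rho> \<Delta> b" "iterated_integral (integrand \<rho> \<Delta> b) (next_varpi \<rho> \<Delta> b) = 1"
proof -
  obtain c where c: "0 < c" "\<And>v. v \<le> -c \<Longrightarrow> b v = 1" using assms(2) by (auto simp: profile_def)
  have "\<exists>!w. 0 < w \<and> iterated_integral (integrand \<rho> \<Delta> b) w = 1"
    using iterated_integral_eq_1_unique[OF integrand_continuous[OF assms] integrand_pos[OF assms(2)] c(1)]
      integrand_ge[of b] c(2) by metis
  from theI'[OF this]
  show "0 < next_varpi \<rho> \<Delta> b" "iterated_integral (integrand \<rho> \<Delta> b) (next_varpi \<rho> \<Delta> b) = 1"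
    by (auto simp: next_varpi_def double_integral_iterated_integral)
qed

lemma double_integral_deriv:
  fixes t w :: real
  assumes "0 \<le> \<Delta>" "profile b" "t \<in> {-w..0}"
  shows "(double_integral \<rho> \<Delta> b w has_real_derivative integral {-w..t} (integrand \<rho> \<Delta> b)) (at t within {-w..0})"
proof -
  have g: "continuous_on {-w..0} (integrand \<rho> \<Delta> b)"
    using integrand_continuous[OF assms(1,2)] by (rule continuous_on_subset) auto
  have "continuous_on {-w..0} (\<lambda>u. integral {-w..u} (integrand \<rho> \<Delta> b))"
    using integral_has_real_derivative[OF g] by (rule DERIV_continuous_on)
  from integral_has_real_derivative[OF this assms(3)] show ?thesis
    unfolding double_integral_def[abs_def] .
qed

lemma integral_integrand_ge:
  assumes "0 \<le> \<Delta>" "profile b" "-w \<le> t" "t \<le> 0"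
  shows "b t * (t + w) \<le> integral {-w..t} (integrand \<rho> \<Delta> b)"
proof -
  have "b t * (t - (-w)) \<le> integral {-w..t} (integrand \<rho> \<Delta> b)"
  proof (rule const_le_integral)
    show "continuous_on {-w..t} (integrand \<rho> \<Delta> b)"
      using integrand_continuous[OF assms(1,2)] by (rule continuous_on_subset) (use assms in auto)
    show "b t \<le> integrand \<rho> \<Delta> b u" if "u \<in> {-w..t}" for u
      using profileD(2)[OF assms(2), of u t] that assms(4) integrand_ge[of b u] by (meson atLeastAtMost_iff order_trans)
  qed (use assms in simp)
  then show ?thesis by simp
qed

text \<open>This invariant keeps the recursion meaningful, as \<open>next_varpi\<close> is well
  defined for a profile. Positivity on the open half-line holds because the double integral
  increases strictly towards the value 1, reached only at the origin.\<close>

lemma profile_next: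
  fixes \<rho> \<Delta> :: real and b :: "real \<Rightarrow> real"
  assumes "0 \<le> \<Delta>" "profile b"
  defines "w \<equiv> next_varpi \<rho> \<Delta> b"
  shows "profile (\<lambda>t. if t \<le> - w then 1 else 1 - double_integral \<rho> \<Delta> b w t)" (is "profile ?f")
proof -
  have w: "0 < w" "double_integral \<rho> \<Delta> b w 0 = 1"
    using next_varpi[OF assms(1,2)] by (simp_all add: w_def double_integral_iterated_integral)
  let ?I = "double_integral \<rho> \<Delta> b w" and ?H = "\<lambda>u. integral {-w..u} (integrand \<rho> \<Delta> b)"
  have I: "(?I has_real_derivative ?H t) (at t within {-w..0})" if "t \<in> {-w..0}" for t
    using double_integral_deriv[OF assms(1,2) that] .
  have Icont: "continuous_on {-w..0} ?I" using I by (rule DERIV_continuous_on)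
  have H: "0 \<le> ?H t" if "t \<in> {-w..0}" for t
    using integral_integrand_ge[OF assms(1,2), of w t \<rho>] profile_nonneg[OF assms(2), of t] that
    by (smt (verit) atLeastAtMost_iff mult_nonneg_nonneg)
  \<comment> \<open>Clamping at \<open>-w\<close> removes the case distinction, as the double
    integral over a single point is 0.\<close>
  have f: "?f t = 1 - ?I (max t (-w))" for t by (auto simp: double_integral_def)
  have mono: "?I s \<le> ?I t" if "-w \<le> s" "s \<le> t" "t \<le> 0" for s t
  proof -
    have "- ?I t \<le> - ?I s"
      by (rule nonincreasing_of_deriv[OF that(2) DERIV_minus[OF DERIV_subset[OF I]]]) (use that H in auto)
    then show ?thesis by simp
  qed
  have strict: "?I u < ?I 0" if "-w \<le> u" "u < 0" for u
  proof (rule DERIV_pos_imp_increasing_open[OF that(2)])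
    fix t assume t: "u < t" "t < 0"
    have "(?I has_real_derivative ?H t) (at t)"
      using I[of t] at_within_interior[of t "{-w..0}"] t that by simp
    moreover have "0 < b t * (t + w)" using profileD(3)[OF assms(2)] t that by simp
    then have "0 < ?H t" using integral_integrand_ge[OF assms(1,2), of w t \<rho>] t that by linarith
    ultimately show "\<exists>y. (?I has_real_derivative y) (at t) \<and> 0 < y" by blast
  next
    show "continuous_on {u..0} ?I" using Icont by (rule continuous_on_subset) (use that in auto)
  qed
  show ?thesis
    unfolding profile_def
  proof (intro conjI allI impI)
    show "continuous_on {..0} ?f"
      unfolding f using w(1) by (intro continuous_intros continuous_on_compose2[OF Icont]) auto
    show "?f t \<le> ?f s" if "s \<le> t" "t \<le> 0" for s t
      unfolding f using mono[of "max s (-w)" "max t (-w)"] that w(1) by (auto simp: max_def)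
    show "0 < ?f v" if "v < 0" for v unfolding f using strict[of "max v (-w)"] that w by simp
    show "0 \<le> ?f 0" using w by simp
    show "\<exists>c>0. \<forall>v\<le>-c. ?f v = 1" using w(1) by auto
  qed
qed

lemma profile_\<beta>: "0 \<le> \<Delta> \<Longrightarrow> profile (\<beta> \<rho> \<Delta> n)"
proof (induction n)
  case 0
  show ?case by (auto simp: profile_def intro!: exI[of _ "1::real"])
next
  case (Suc n)
  then show ?case by (simp add: profile_next)
qed

text \<open>To the left of \<open>- varpi \<rho> \<Delta> n\<close> the function
  \<open>\<beta> \<rho> \<Delta> (Suc n)\<close> is 1, so \<open>U \<le> 1\<close> extends the
  comparison to all of \<open>{-A..0}\<close>.\<close>

lemma \<beta>_comparison:
  fixes \<rho> \<Delta> A :: real and U U' :: "real \<Rightarrow> real"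
  defines "g \<equiv> \<lambda>n. integrand \<rho> \<Delta> (\<beta> \<rho> \<Delta> n)"
  assumes "0 \<le> \<Delta>" "0 < A"
    and U: "\<And>v. v \<in> {-A..0} \<Longrightarrow> (U has_real_derivative U' v) (at v within {-A..0})"
    and U'_incr: "\<And>s t. -A \<le> s \<Longrightarrow> s \<le> t \<Longrightarrow> t \<le> 0 \<Longrightarrow> - integral {s..t} (g n) \<le> U' t - U' s"
    and bc: "U (-A) = 1" "U' (-A) = 0" "U 0 \<le> 0"
    and le1: "\<And>v. v \<in> {-A..0} \<Longrightarrow> U v \<le> 1"
  shows "varpi \<rho> \<Delta> n \<le> A" and "\<And>v. v \<in> {-A..0} \<Longrightarrow> U v \<le> \<beta> \<rho> \<Delta> (Suc n) v"
proof -
  let ?w = "varpi \<rho> \<Delta> n"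
  note p = profile_\<beta>[OF \<open>0 \<le> \<Delta>\<close>, of \<rho> n]
  have w: "0 < ?w" "iterated_integral (g n) ?w = 1"
    using next_varpi[OF \<open>0 \<le> \<Delta>\<close> p] by (simp_all add: varpi_def g_def)
  have g: "continuous_on {..0} (g n)" "\<And>v. v < 0 \<Longrightarrow> 0 < g n v"
    using integrand_continuous[OF \<open>0 \<le> \<Delta>\<close> p] integrand_pos[OF p] by (simp_all add: g_def)
  note cmp = iterated_integral_comparison[OF g w \<open>0 < A\<close> U U'_incr bc le1]
  show "?w \<le> A" by (rule cmp(1))
  show "U v \<le> \<beta> \<rho> \<Delta> (Suc n) v" if "v \<in> {-A..0}" for v
  proof (cases "v \<le> - ?w")
    case True
    then show ?thesis using le1[OF that] by (simp add: varpi_def)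
  next
    case False
    then have "U v \<le> 1 - double_integral \<rho> \<Delta> (\<beta> \<rho> \<Delta> n) ?w v"
      using cmp(2)[of v] that by (simp add: double_integral_def g_def)
    then show ?thesis using False by (simp add: varpi_def)
  qed
qed

lemma \<beta>_left: "v \<le> - varpi \<rho> \<Delta> n \<Longrightarrow> \<beta> \<rho> \<Delta> (Suc n) v = 1"
  by (simp add: varpi_def)

text \<open>Minus the second derivative of \<open>\<beta> \<rho> \<Delta> (Suc (Suc n))\<close> is
  the integrand with index \<open>Suc n\<close>, which by hypothesis does not exceed the one with
  index \<open>n\<close>. So this function is admissible in \<open>\<beta>_comparison\<close> with
  \<open>A = varpi \<rho> \<Delta> (Suc n)\<close>.\<close>

lemma \<beta>_Suc_step:
  assumes "0 \<le> \<Delta>" "\<And>v. v \<le> 0 \<Longrightarrow> \<beta> \<rho> \<Delta> (Suc n) v \<le> \<beta> \<rho> \<Delta> n v"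
  shows "varpi \<rho> \<Delta> n \<le> varpi \<rho> \<Delta> (Suc n)"
    and "\<And>v. v \<le> 0 \<Longrightarrow> \<beta> \<rho> \<Delta> (Suc (Suc n)) v \<le> \<beta> \<rho> \<Delta> (Suc n) v"
proof -
  let ?w = "varpi \<rho> \<Delta> (Suc n)" and ?b = "\<beta> \<rho> \<Delta> (Suc n)"
  let ?g = "\<lambda>n. integrand \<rho> \<Delta> (\<beta> \<rho> \<Delta> n)"
  let ?U = "\<lambda>v. 1 - double_integral \<rho> \<Delta> ?b ?w v" and ?U' = "\<lambda>v. - integral {- ?w..v} (?g (Suc n))"
  note p = profile_\<beta>[OF assms(1), of \<rho>]
  have w: "0 < ?w" "double_integral \<rho> \<Delta> ?b ?w 0 = 1"
    using next_varpi[OF assms(1) p[of "Suc n"]] by (simp_all only: varpi_def double_integral_iterated_integral)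
  \<comment> \<open>At \<open>v = - ?w\<close> both branches give 1, so the formula without case
    distinction holds up to that end.\<close>
  have b: "\<beta> \<rho> \<Delta> (Suc (Suc n)) v = ?U v" if "- ?w \<le> v" for v
    using that by (subst \<beta>.simps(2)) (auto simp: varpi_def[symmetric] double_integral_def simp del: \<beta>.simps)
  have int: "?g n integrable_on {s..t}" if "t \<le> 0" for n s t
    by (intro integrable_continuous_real continuous_on_subset[OF integrand_continuous[OF assms(1) p]])
      (use that in auto)
  have U: "(?U has_real_derivative ?U' v) (at v within {- ?w..0})" if "v \<in> {- ?w..0}" for v
    using DERIV_diff[OF DERIV_const double_integral_deriv[OF assms(1) p[of "Suc n"] that]] by simp
  have U'_incr: "- integral {s..t} (?g n) \<le> ?U' t - ?U' s" if "- ?w \<le> s" "s \<le> t" "t \<le> 0" for s t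
  proof -
    have "?U' t - ?U' s = - integral {s..t} (?g (Suc n))"
      using Henstock_Kurzweil_Integration.integral_combine[OF that(1,2) int[OF that(3), of "Suc n"]] by simp
    moreover have "integral {s..t} (?g (Suc n)) \<le> integral {s..t} (?g n)"
      using that by (intro integral_le int integrand_mono assms(2)) auto
    ultimately show ?thesis by linarith
  qed
  have le1: "?U v \<le> 1" if "v \<in> {- ?w..0}" for v
    using profile_le_1[OF p[of "Suc (Suc n)"], of v] b[of v] that by simp
  have bc: "?U (- ?w) = 1" "?U' (- ?w) = 0" "?U 0 \<le> 0" using w by (simp_all add: double_integral_def)
  note cmp = \<beta>_comparison[OF assms(1) w(1) U U'_incr bc le1]
  show "varpi \<rho> \<Delta> n \<le> varpi \<rho> \<Delta> (Suc n)" by (rule cmp(1))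
  show "\<beta> \<rho> \<Delta> (Suc (Suc n)) v \<le> \<beta> \<rho> \<Delta> (Suc n) v" if "v \<le> 0" for v
  proof (cases "- ?w \<le> v")
    case True
    then show ?thesis using cmp(2)[of v] b[of v] that by (simp del: \<beta>.simps)
  next
    case False
    then have "v \<le> - varpi \<rho> \<Delta> n" using cmp(1) by simp
    then show ?thesis using profile_le_1[OF p that, of "Suc (Suc n)"] \<beta>_left[of v \<rho> \<Delta> n] by simp
  qed
qed

lemma \<beta>_antimono:
  assumes "0 \<le> \<Delta>" "v \<le> 0"
  shows "\<beta> \<rho> \<Delta> (Suc n) v \<le> \<beta> \<rho> \<Delta> n v"
  using assms(2)
proof (induction n arbitrary: v)
  case 0
  then show ?case using profile_le_1[OF profile_\<beta>[OF assms(1)], of v \<rho> 1] by simp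
next
  case (Suc n)
  then show ?case using \<beta>_Suc_step(2)[OF assms(1)] by blast
qed

lemma varpi_mono: "0 \<le> \<Delta> \<Longrightarrow> varpi \<rho> \<Delta> n \<le> varpi \<rho> \<Delta> (Suc n)"
  by (rule \<beta>_Suc_step(1)) (auto intro: \<beta>_antimono simp del: \<beta>.simps)

text \<open>\<open>lim\<close> is informative only for a convergent sequence. The bound
  \<open>A\<close> serves twice, for the convergence of the nondecreasing sequence and for the
  estimate of its limit.\<close>

lemma \<Psi>_le:
  assumes "0 \<le> \<Delta>" "\<And>n. varpi \<rho> \<Delta> n \<le> A"
  shows "\<Psi> \<rho> \<Delta> \<le> A"
proof -
  have "incseq (varpi \<rho> \<Delta>)" using varpi_mono[OF assms(1)] by (simp add: incseq_Suc_iff)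
  then obtain L where "varpi \<rho> \<Delta> \<longlonglongrightarrow> L" using incseq_convergent assms(2) by metis
  then show ?thesis unfolding \<Psi>_def using LIMSEQ_le_const2[of _ L A] assms(2) by (simp add: limI)
qed

lemma le_y:
  assumes "0 \<le> \<Delta>" "w \<le> 0" "\<And>n. c \<le> \<beta> \<rho> \<Delta> n w"
  shows "c \<le> y \<rho> \<Delta> w"
proof -
  have "decseq (\<lambda>n. \<beta> \<rho> \<Delta> n w)"
    using \<beta>_antimono[OF assms(1,2)] by (simp add: decseq_Suc_iff del: \<beta>.simps)
  then obtain L where "(\<lambda>n. \<beta> \<rho> \<Delta> n w) \<longlonglongrightarrow> L" using decseq_convergent assms(3) by metis
  then show ?thesis unfolding y_def using LIMSEQ_le_const[of _ L c] assms(3) by (simp add: limI)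
qed

section \<open>Comparison with the solution\<close>

lemma AE_lebesgue_on_obtain_negligible:
  assumes "AE t in lebesgue_on S. P t" "S \<in> sets lebesgue"
  obtains N where "negligible N" "\<And>t. t \<in> S - N \<Longrightarrow> P t"
proof -
  have "AE t in lebesgue. t \<in> S \<longrightarrow> P t" using assms by (simp add: AE_restrict_space_iff)
  then obtain N where "{t \<in> space lebesgue. \<not> (t \<in> S \<longrightarrow> P t)} \<subseteq> N" "N \<in> null_sets lebesgue"
    by (auto elim!: AE_E3 simp: eventually_ae_filter)
  then show thesis by (intro that[of N]) (auto simp: negligible_iff_null_sets)
qed

text \<open>\<open>real_of_ereal\<close> sends infinity to 0, so the essential supremum on the
  half-line must first be shown finite; it is dominated by the one on the whole line.\<close>

lemma max_delay_AE:
  assumes "\<tau> \<in> borel_measurable lebesgue" "esssup lebesgue (\<lambda>t. ereal (\<tau> t)) < \<infinity>"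
  shows "AE t in lebesgue_on {s..}. \<tau> t \<le> max_delay \<tau> s"
proof -
  let ?E = "esssup (lebesgue_on {s..}) (\<lambda>t. ereal (\<tau> t))"
  have "AE t in lebesgue. ereal (\<tau> t) \<le> esssup lebesgue (\<lambda>t. ereal (\<tau> t))" by (rule esssup_AE)
  then have "AE t in lebesgue_on {s..}. ereal (\<tau> t) \<le> esssup lebesgue (\<lambda>t. ereal (\<tau> t))"
    by (subst AE_restrict_space_iff) auto
  moreover have "(\<lambda>t. ereal (\<tau> t)) \<in> borel_measurable (lebesgue_on {s..})"
    using assms(1) by (intro borel_measurable_ereal measurable_restrict_space1)
  ultimately have "?E \<le> esssup lebesgue (\<lambda>t. ereal (\<tau> t))" by (intro esssup_I)
  then have "?E < \<infinity>" using assms(2) by (rule le_less_trans)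
  moreover have "AE t in lebesgue_on {s..}. ereal (\<tau> t) \<le> ?E" by (rule esssup_AE)
  ultimately show ?thesis
    unfolding max_delay_def by (cases ?E) (auto elim!: AE_mp)
qed

lemma max_delay_nonneg:
  assumes "\<tau> \<in> borel_measurable lebesgue" "esssup lebesgue (\<lambda>t. ereal (\<tau> t)) < \<infinity>" "\<And>t. 0 \<le> \<tau> t"
  shows "0 \<le> max_delay \<tau> s"
proof -
  obtain N where N: "negligible N" "\<And>t. t \<in> {s..} - N \<Longrightarrow> \<tau> t \<le> max_delay \<tau> s"
    using AE_lebesgue_on_obtain_negligible[OF max_delay_AE[OF assms(1,2), of s]] by auto
  have "\<not> negligible {s..s+1}" using negligible_interval(1)[of s "s + 1"] by simp
  then have "\<not> {s..s+1} \<subseteq> N" using N(1) negligible_subset by blast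
  then obtain t where "t \<in> {s..s+1}" "t \<notin> N" by blast
  then have "t \<in> {s..} - N" by simp
  then show ?thesis using N(2)[of t] assms(3)[of t] by simp
qed

lemma solution_le_\<beta>_step:
  assumes "0 \<le> \<Delta>" "0 < \<rho>" "0 < A" "0 \<le> M" "M \<le> \<Delta>"
    and x: "\<And>t. t \<in> {0..A} \<Longrightarrow> (x has_real_derivative x' t) (at t within {0..A})"
    and ac: "abs_cont_on_interval x' 0 A" and N: "negligible N"
    and eq: "\<And>t. t \<in> {0..A} - N \<Longrightarrow> \<exists>D u. (x' has_real_derivative D) (at t) \<and> \<bar>D\<bar> \<le> \<bar>x u\<bar> \<and>
      t - M \<le> u \<and> u \<le> t"
    and pre: "\<And>s. s \<in> {- M..0} \<Longrightarrow> \<bar>x s\<bar> \<le> \<rho> * r \<Delta> (\<theta> \<Delta> + s)"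
    and bc: "x 0 = 0" "x A = 1" "x' A = 0" and range: "\<And>t. t \<in> {0..A} \<Longrightarrow> 0 \<le> x t \<and> x t \<le> 1"
    and le: "\<And>t. t \<in> {0..A} \<Longrightarrow> x t \<le> \<beta> \<rho> \<Delta> n (-t)"
  shows "varpi \<rho> \<Delta> n \<le> A" and "\<And>t. t \<in> {0..A} \<Longrightarrow> x t \<le> \<beta> \<rho> \<Delta> (Suc n) (-t)"
proof -
  let ?b = "\<beta> \<rho> \<Delta> n"
  let ?g = "integrand \<rho> \<Delta> ?b" and ?U = "\<lambda>v. x (- v)" and ?U' = "\<lambda>v. - x' (- v)"
  note p = profile_\<beta>[OF assms(1), of \<rho> n]
  have delayed: "\<bar>x u\<bar> \<le> ?g (- t)" if t: "t \<in> {0..A}" and u: "t - M \<le> u" "u \<le> t" for t u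
  proof (cases "0 \<le> u")
    case True
    then have "\<bar>x u\<bar> \<le> ?b (- u)" using range[of u] le[of u] t u by auto
    also have "\<dots> \<le> ?b (- t)" using profileD(2)[OF p, of "- t" "- u"] True u by simp
    also have "\<dots> \<le> ?g (- t)" by (rule integrand_ge)
    finally show ?thesis .
  next
    case False
    \<comment> \<open>From \<open>t - M \<le> u\<close>, \<open>u < 0\<close> and
      \<open>M \<le> \<Delta>\<close> follow \<open>t \<le> \<Delta>\<close>, so that the indicator
      at \<open>- t\<close> is 1, and \<open>t - \<Delta> \<le> u\<close>, so that the nonincreasing
      \<open>r\<close> may be taken at the earlier time.\<close>
    then have "\<bar>x u\<bar> \<le> \<rho> * r \<Delta> (\<theta> \<Delta> + u)" using pre[of u] t u by simp
    also have "\<dots> \<le> \<rho> * r \<Delta> (\<theta> \<Delta> - (- t) - \<Delta>)"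
      using t u False assms(2,5) by (intro mult_left_mono r_antimono[OF assms(1)]) auto
    also have "\<dots> \<le> ?g (- t)"
      using t u False assms(5) by (simp add: integrand_def indicator_def)
    finally show ?thesis .
  qed
  have U: "(?U has_real_derivative ?U' v) (at v within {-A..0})" if "v \<in> {-A..0}" for v
  proof -
    have "(x has_real_derivative x' (- v)) (at (- v) within uminus ` {-A..0})" using x[of "- v"] that by simp
    then show ?thesis
      using DERIV_image_chain[of x _ uminus v "{-A..0}" "-1"] by (simp add: o_def DERIV_minus)
  qed
  have U'_incr: "- integral {s..t} ?g \<le> ?U' t - ?U' s" if st: "-A \<le> s" "s \<le> t" "t \<le> 0" for s t
  proof -
    \<comment> \<open>In the time variable of the solution, this is the primitive of the reflected
      integrand that vanishes at \<open>- t\<close>.\<close>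
    let ?G = "\<lambda>u. integral {- u..t} ?g"
    have gc: "continuous_on {s..t} ?g"
      using integrand_continuous[OF assms(1) p] by (rule continuous_on_subset) (use st in auto)
    have "(- 1) * x' (- s) - (- 1) * x' (- t) \<le> ?G (- s) - ?G (- t)"
    proof (rule abs_cont_increment_le[where g = "\<lambda>u. ?g (- u)"])
      show "abs_cont_on_interval x' (- t) (- s)" using ac by (rule abs_cont_on_subinterval) (use st in auto)
      show "(?G has_real_derivative ?g (- u)) (at u within {- t..- s})" if u: "u \<in> {- t..- s}" for u
      proof -
        have "((\<lambda>a. integral {a..t} ?g) has_real_derivative - ?g (- u)) (at (- u) within uminus ` {- t..- s})"
          using integral_has_real_derivative'[OF gc, of "- u"] u by auto
        then show ?thesis
          using DERIV_image_chain[of "\<lambda>a. integral {a..t} ?g" "- ?g (- u)" uminus u "{- t..- s}" "-1"] by (simp add: o_def DERIV_minus)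
      qed
      show "continuous_on {- t..- s} (\<lambda>u. ?g (- u))"
        by (intro continuous_on_compose2[OF gc] continuous_intros) auto
      show "\<exists>D. (x' has_real_derivative D) (at u) \<and> - 1 * D \<le> ?g (- u)" if u: "u \<in> {- t..- s} - N" for u
      proof -
        have u': "u \<in> {0..A} - N" using u st by auto
        then obtain D v where D: "(x' has_real_derivative D) (at u)" "\<bar>D\<bar> \<le> \<bar>x v\<bar>" "u - M \<le> v" "v \<le> u"
          using eq by blast
        then have "- 1 * D \<le> ?g (- u)" using delayed[of u v] u' by auto
        then show ?thesis using D(1) by blast
      qed
    qed (use st N in auto)
    moreover have "?G (- t) = 0" by simp
    ultimately show ?thesis by simp
  qed
  have bc': "?U (- A) = 1" "?U' (- A) = 0" "?U 0 \<le> 0" using bc by simp_all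
  have le1: "?U v \<le> 1" if "v \<in> {-A..0}" for v using range[of "- v"] that by simp
  note cmp = \<beta>_comparison[OF assms(1,3) U U'_incr bc' le1]
  show "varpi \<rho> \<Delta> n \<le> A" by (rule cmp(1))
  show "x t \<le> \<beta> \<rho> \<Delta> (Suc n) (-t)" if "t \<in> {0..A}" for t
    using cmp(2)[of "- t"] that by (simp del: \<beta>.simps)
qed

theorem theorem11:
  fixes \<Delta> \<rho> A :: real and p \<tau> x :: "real \<Rightarrow> real"
  assumes "0 \<le> \<Delta>" and "0 < \<rho>" and "0 < A"
    and "p \<in> borel_measurable lebesgue"
    and "esssup lebesgue (\<lambda>t. ereal \<bar>p t\<bar>) \<le> 1"
    and "\<tau> \<in> borel_measurable lebesgue"
    and "\<forall>t. 0 \<le> \<tau> t"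
    and "esssup lebesgue (\<lambda>t. ereal (\<tau> t)) < \<infinity>"
    and "max_delay \<tau> (- \<theta> \<Delta>) \<le> \<Delta>"
    and "delay_solution p \<tau> (- \<theta> \<Delta>) x"
    and "\<forall>t\<in>{- \<Delta> - \<theta> \<Delta>..0}. - \<theta> \<Delta> - max_delay \<tau> (- \<theta> \<Delta>) \<le> t \<longrightarrow> \<bar>x t\<bar> \<le> \<rho>"
    and "x 0 = 0"
    and "\<forall>t\<in>{0..A}. 0 \<le> x t \<and> x t \<le> 1"
    and "x A = 1"
    and "(x has_real_derivative 0) (at A)"
  shows "\<Psi> \<rho> \<Delta> \<le> A \<and> (\<forall>t\<in>{0..\<Psi> \<rho> \<Delta>}. x t \<le> y \<rho> \<Delta> (- t))"
proof -
  \<comment> \<open>The delay window has length \<open>M\<close> and not \<open>\<Delta>\<close>,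
    because \<open>x\<close> is constrained only from \<open>- \<theta> \<Delta> - M\<close>
    on.\<close>
  define M where "M = max_delay \<tau> (- \<theta> \<Delta>)"
  let ?a = "- \<theta> \<Delta> - M"
  have \<theta>: "0 < \<theta> \<Delta>" by (rule r_first_zero(1)[OF assms(1)])
  have M: "0 \<le> M" "M \<le> \<Delta>" using max_delay_nonneg[OF assms(6,8)] assms(7,9) by (auto simp: M_def)
  obtain x' where x: "\<And>t. ?a \<le> t \<Longrightarrow> (x has_real_derivative x' t) (at t within {?a..})"
    and ac: "abs_cont_from ?a x'"
    and ode: "AE t in lebesgue_on {- \<theta> \<Delta>..}. (x' has_real_derivative - p t * x (t - \<tau> t)) (at t)"
    using assms(10) unfolding delay_solution_def Let_def M_def by blast
  have "AE t in lebesgue. ereal \<bar>p t\<bar> \<le> 1"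
    using esssup_AE[of "\<lambda>t. ereal \<bar>p t\<bar>" lebesgue] by eventually_elim (rule order_trans[OF _ assms(5)])
  then have "AE t in lebesgue_on {- \<theta> \<Delta>..}. \<bar>p t\<bar> \<le> 1" by (subst AE_restrict_space_iff) auto
  with ode max_delay_AE[OF assms(6,8), of "- \<theta> \<Delta>"]
  have "AE t in lebesgue_on {- \<theta> \<Delta>..}. (x' has_real_derivative - p t * x (t - \<tau> t)) (at t) \<and> \<bar>p t\<bar> \<le> 1 \<and> \<tau> t \<le> M"
    unfolding M_def by eventually_elim blast
  then obtain N where N: "negligible N" "\<And>t. t \<in> {- \<theta> \<Delta>..} - N \<Longrightarrow>
      (x' has_real_derivative - p t * x (t - \<tau> t)) (at t) \<and> \<bar>p t\<bar> \<le> 1 \<and> \<tau> t \<le> M"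
    by (rule AE_lebesgue_on_obtain_negligible) auto
  \<comment> \<open>This form hides \<open>p\<close> and \<open>\<tau>\<close>: both comparisons use
    only that |x''| is bounded by some value of |x| in the window \<open>[t - M, t]\<close>.\<close>
  have eq: "\<exists>D u. (x' has_real_derivative D) (at t) \<and> \<bar>D\<bar> \<le> \<bar>x u\<bar> \<and> t - M \<le> u \<and> u \<le> t"
    if "- \<theta> \<Delta> \<le> t" "t \<notin> N" for t
  proof -
    have t: "(x' has_real_derivative - p t * x (t - \<tau> t)) (at t)" "\<bar>p t\<bar> \<le> 1" "\<tau> t \<le> M" using N(2)[of t] that by auto
    have "\<bar>- p t * x (t - \<tau> t)\<bar> \<le> \<bar>x (t - \<tau> t)\<bar>"
      using mult_right_mono[OF t(2), of "\<bar>x (t - \<tau> t)\<bar>"] by (simp add: abs_mult)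
    then show ?thesis using t assms(7) by (intro exI[of _ "- p t * x (t - \<tau> t)"] exI[of _ "t - \<tau> t"]) auto
  qed
  have ac': "abs_cont_on_interval x' s t" if "?a \<le> s" "s \<le> t" for s t
  proof -
    have "abs_cont_on_interval x' ?a t" using ac that unfolding abs_cont_from_def by simp
    then show ?thesis using that(1) by (rule abs_cont_on_subinterval) simp
  qed
  have pre: "\<bar>x s\<bar> \<le> \<rho> * r \<Delta> (\<theta> \<Delta> + s)" if "s \<in> {?a..0}" for s
  proof (rule prehistory_bound[OF M assms(2) x _ N(1) _ _ assms(12) that])
    show "abs_cont_on_interval x' (- \<theta> \<Delta>) 0" using \<theta> M by (intro ac') auto
    show "\<bar>x t\<bar> \<le> \<rho>" if "t \<in> {?a..0}" for t using assms(11) that M by (auto simp: M_def)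
  qed (use eq in auto)
  have x'A: "x' A = 0"
  proof -
    have "at A within {?a..} = at A" using assms(3) \<theta> M by (intro at_within_interior) simp
    then show ?thesis using x[of A] assms(3,15) \<theta> M by (auto intro: DERIV_unique)
  qed
  have step: "varpi \<rho> \<Delta> n \<le> A \<and> (\<forall>t\<in>{0..A}. x t \<le> \<beta> \<rho> \<Delta> (Suc n) (-t))"
    if "\<forall>t\<in>{0..A}. x t \<le> \<beta> \<rho> \<Delta> n (-t)" for n
  proof -
    have xA: "(x has_real_derivative x' t) (at t within {0..A})" if "t \<in> {0..A}" for t
      using that \<theta> M by (intro DERIV_subset[OF x]) auto
    have acA: "abs_cont_on_interval x' 0 A" using \<theta> M assms(3) by (intro ac') auto
    have "varpi \<rho> \<Delta> n \<le> A" "\<And>t. t \<in> {0..A} \<Longrightarrow> x t \<le> \<beta> \<rho> \<Delta> (Suc n) (-t)"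
      by (rule solution_le_\<beta>_step[OF assms(1-3) M xA acA N(1) _ _ assms(12,14) x'A];
        use eq pre assms(13) that \<theta> in auto)+
    then show ?thesis by blast
  qed
  have le: "\<forall>t\<in>{0..A}. x t \<le> \<beta> \<rho> \<Delta> n (-t)" for n
    by (induction n) (use assms(13) step in \<open>auto simp del: \<beta>.simps(2)\<close>)
  have \<Psi>: "\<Psi> \<rho> \<Delta> \<le> A" using \<Psi>_le[OF assms(1)] step le by blast
  moreover have "x t \<le> y \<rho> \<Delta> (- t)" if "t \<in> {0..\<Psi> \<rho> \<Delta>}" for t
    using le_y[OF assms(1), of "- t" "x t" \<rho>] le \<Psi> that by auto
  ultimately show ?thesis by blast
qed

end
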